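(* Let $\mathcal{E}$ be the infinite prolongation of $u_t=u_5+(4\alpha-6\beta)u_1u_2+(8\alpha-2\beta)u_0u_3-20\alpha\beta u_0^2u_1$, with $\alpha,\beta\in\mathbb{K}$, and let $a\in\mathcal{E}$. (1) If $\alpha+\beta\neq0$, $6\alpha+\beta\neq0$, $16\alpha+\beta\neq0$ and $\alpha\neq0$, then $\mathbb{F}^0(\mathcal{E},a)$ is isomorphic to the direct sum of $\mathfrak{sl}_2(\mathbb{K})$ and an abelian Lie algebra of dimension $\le3$. (2) If $\alpha=0$ and $\beta\neq0$, then $\mathbb{F}^0(\mathcal{E},a)$ is nilpotent and of dimension $\le6$.
   Context: $\mathbb{K}$ is $\mathbb{C}$ or $\mathbb{R}$; $u_k=\partial^ku/\partial x^k$. For the evolution equation $u_t=F(u_0,\dots,u_5)$ its infinite prolongation $\mathcal{E}$ is $\mathbb{K}^\infty$ with coordinates $x,t,u_0,u_1,\dots$, with $D_x=\partial_x+\sum_{k\ge0}u_{k+1}\partial_{u_k}$, $D_t=\partial_t+\sum_{k\ge0}D_x^k(F)\partial_{u_k}$. For $a\in\mathcal{E}$ with coordinates $x_a,t_a,a_k$, the Lie algebra $\mathbb{F}^0(\mathcal{E},a)$ has generators $\mathcal{A}^{l_1,l_2}_{i_0}$, $\mathcal{B}^{l_1,l_2}_{j_0j_1j_2j_3j_4}$ (all nonnegative indices) and relations: (i) all coefficients of $D_x(\mathcal{B})-D_t(\mathcal{A})+[\mathcal{A},\mathcal{B}]$ vanish, where $\mathcal{A}=\sum(x-x_a)^{l_1}(t-t_a)^{l_2}(u_0-a_0)^{i_0}\mathcal{A}^{l_1,l_2}_{i_0}$,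 $\mathcal{B}=\sum(x-x_a)^{l_1}(t-t_a)^{l_2}\prod_{r=0}^{4}(u_r-a_r)^{j_r}\mathcal{B}^{l_1,l_2}_{j_0\dots j_4}$, the functions $u_{k+1}$, $D_x^k(F)$ are expanded in Taylor series at $a$, and brackets are computed coefficientwise; (ii) $\mathcal{A}^{l_1,l_2}_{0}=0$ and $\mathcal{B}^{0,l_2}_{00000}=0$ for all $l_1,l_2$. *)

theory Defs
  imports "HOL-Analysis.Determinants" "HOL-Library.Function_Algebras"
begin

text \<open>GA l1 l2 i0 is A^{l1,l2}_{i0}; GB l1 l2 j0 j1 j2 j3 j4 is B^{l1,l2}_{j0 j1 j2 j3 j4}.\<close>
datatype gen = GA nat nat nat | GB nat nat nat nat nat nat nat

type_synonym 'k nc = "gen list \<Rightarrow> 'k"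

definition ncmul :: "'k::comm_ring_1 nc \<Rightarrow> 'k nc \<Rightarrow> 'k nc" where
  "ncmul p q = (\<lambda>w. \<Sum>i\<le>length w. p (take i w) * q (drop i w))"

definition ncbr :: "'k::comm_ring_1 nc \<Rightarrow> 'k nc \<Rightarrow> 'k nc" where
  "ncbr p q = ncmul p q - ncmul q p"

definition smul :: "'k::comm_ring_1 \<Rightarrow> 'k nc \<Rightarrow> 'k nc" where
  "smul c p = (\<lambda>w. c * p w)"

definition letter :: "gen \<Rightarrow> 'k::comm_ring_1 nc" where
  "letter g = (\<lambda>w. if w = [g] then 1 else 0)"

text \<open>The free Lie algebra on gen, realised as the Lie subalgebra of the free
  associative algebra generated by the letters (commutator bracket).\<close>
inductive_set free_lie :: "'k::comm_ring_1 nc set" where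
  fl_letter: "letter g \<in> free_lie"
| fl_zero: "0 \<in> free_lie"
| fl_add: "x \<in> free_lie \<Longrightarrow> y \<in> free_lie \<Longrightarrow> x + y \<in> free_lie"
| fl_smul: "x \<in> free_lie \<Longrightarrow> smul c x \<in> free_lie"
| fl_br: "x \<in> free_lie \<Longrightarrow> y \<in> free_lie \<Longrightarrow> ncbr x y \<in> free_lie"

inductive_set lie_ideal_gen :: "'k::comm_ring_1 nc set \<Rightarrow> 'k nc set" for R where
  li_rel: "r \<in> R \<Longrightarrow> r \<in> lie_ideal_gen R"
| li_zero: "0 \<in> lie_ideal_gen R"
| li_add: "x \<in> lie_ideal_gen R \<Longrightarrow> y \<in> lie_ideal_gen R \<Longrightarrow> x + y \<in> lie_ideal_gen R"
| li_smul: "x \<in> lie_ideal_gen R \<Longrightarrow> smul c x \<in> lie_ideal_gen R"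
| li_br: "x \<in> free_lie \<Longrightarrow> y \<in> lie_ideal_gen R \<Longrightarrow> ncbr x y \<in> lie_ideal_gen R"

text \<open>Monomials are exponent functions e :: nat => nat; variable 0 is X = x - x_a,
  variable 1 is T = t - t_a, variable k+2 is U_k = u_k - a_k.\<close>
type_synonym 'k ser = "(nat \<Rightarrow> nat) \<Rightarrow> 'k nc"

definition dvar :: "nat \<Rightarrow> 'k::comm_ring_1 ser \<Rightarrow> 'k ser" where
  "dvar j S = (\<lambda>e. smul (of_nat (e j + 1)) (S (e(j := e j + 1))))"

definition mulvar :: "nat \<Rightarrow> 'k::comm_ring_1 ser \<Rightarrow> 'k ser" where
  "mulvar j S = (\<lambda>e. if 1 \<le> e j then S (e(j := e j - 1)) else 0)"

definition sscale :: "'k::comm_ring_1 \<Rightarrow> 'k ser \<Rightarrow> 'k ser" where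
  "sscale c S = (\<lambda>e. smul c (S e))"

text \<open>Multiplication by the function u_k = a_k + U_k (exact Taylor expansion at a).\<close>
definition mulU :: "(nat \<Rightarrow> 'k::comm_ring_1) \<Rightarrow> nat \<Rightarrow> 'k ser \<Rightarrow> 'k ser" where
  "mulU a k S = (\<lambda>e. sscale (a k) S e + mulvar (k + 2) S e)"

definition sbr :: "'k::comm_ring_1 ser \<Rightarrow> 'k ser \<Rightarrow> 'k ser" where
  "sbr S S' = (\<lambda>e. \<Sum>e1\<in>{e1. \<forall>i. e1 i \<le> e i}. ncbr (S e1) (S' (\<lambda>i. e i - e1 i)))"

definition Aser :: "'k::comm_ring_1 ser" where
  "Aser = (\<lambda>e. if \<forall>i\<ge>3. e i = 0 then letter (GA (e 0) (e 1) (e 2)) else 0)"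

definition Bser :: "'k::comm_ring_1 ser" where
  "Bser = (\<lambda>e. if \<forall>i\<ge>7. e i = 0
      then letter (GB (e 0) (e 1) (e 2) (e 3) (e 4) (e 5) (e 6)) else 0)"

text \<open>Total derivative D_x applied to B (which depends on x,t,u_0..u_4 only):
  D_x = d_x + sum_k u_{k+1} d_{u_k}; the terms k >= 5 vanish on B.\<close>
definition DxB :: "(nat \<Rightarrow> 'k::comm_ring_1) \<Rightarrow> 'k ser" where
  "DxB a = (\<lambda>e. dvar 0 Bser e + (\<Sum>k\<le>4. mulU a (k + 1) (dvar (k + 2) Bser) e))"

definition mulF :: "'k::comm_ring_1 \<Rightarrow> 'k \<Rightarrow> (nat \<Rightarrow> 'k) \<Rightarrow> 'k ser \<Rightarrow> 'k ser" where
  "mulF \<alpha> \<beta> a S = (\<lambda>e. mulU a 5 S e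
      + sscale (4 * \<alpha> - 6 * \<beta>) (mulU a 1 (mulU a 2 S)) e
      + sscale (8 * \<alpha> - 2 * \<beta>) (mulU a 0 (mulU a 3 S)) e
      - sscale (20 * \<alpha> * \<beta>) (mulU a 0 (mulU a 0 (mulU a 1 S))) e)"

text \<open>Total derivative D_t applied to A (which depends on x,t,u_0 only):
  D_t = d_t + sum_k D_x^k(F) d_{u_k}; only k = 0 contributes on A.\<close>
definition DtA :: "'k::comm_ring_1 \<Rightarrow> 'k \<Rightarrow> (nat \<Rightarrow> 'k) \<Rightarrow> 'k ser" where
  "DtA \<alpha> \<beta> a = (\<lambda>e. dvar 1 Aser e + mulF \<alpha> \<beta> a (dvar 2 Aser) e)"

text \<open>Relators (i) and (ii).  Only x_a, t_a enter through the shifted variables,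
  so they do not appear explicitly; a k is the coordinate a_k.\<close>
definition relators :: "'k::comm_ring_1 \<Rightarrow> 'k \<Rightarrow> (nat \<Rightarrow> 'k) \<Rightarrow> 'k nc set" where
  "relators \<alpha> \<beta> a =
     {DxB a e - DtA \<alpha> \<beta> a e + sbr Aser Bser e | e. \<forall>i\<ge>8. e i = 0}
   \<union> {letter (GA l1 l2 0) | l1 l2. True}
   \<union> {letter (GB 0 l2 0 0 0 0 0) | l2. True}"

text \<open>F^0(E,a) = free_lie / F0_ideal.\<close>
definition F0_ideal :: "'k::comm_ring_1 \<Rightarrow> 'k \<Rightarrow> (nat \<Rightarrow> 'k) \<Rightarrow> 'k nc set" where
  "F0_ideal \<alpha> \<beta> a = lie_ideal_gen (relators \<alpha> \<beta> a)"

definition sl2 :: "('k::comm_ring_1^2^2) set" where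
  "sl2 = {M. trace M = 0}"

definition tgt_set :: "nat \<Rightarrow> (('k::comm_ring_1^2^2) \<times> (nat \<Rightarrow> 'k)) set" where
  "tgt_set n = {(M, v). M \<in> sl2 \<and> (\<forall>i\<ge>n. v i = 0)}"

definition tgt_add :: "(('k::comm_ring_1^2^2) \<times> (nat \<Rightarrow> 'k)) \<Rightarrow> _ \<Rightarrow> _" where
  "tgt_add p q = (fst p + fst q, \<lambda>i. snd p i + snd q i)"

definition tgt_smul :: "'k::comm_ring_1 \<Rightarrow> (('k^2^2) \<times> (nat \<Rightarrow> 'k)) \<Rightarrow> _" where
  "tgt_smul c p = ((\<chi> i j. c * fst p $ i $ j), \<lambda>i. c * snd p i)"

definition tgt_br :: "(('k::comm_ring_1^2^2) \<times> (nat \<Rightarrow> 'k)) \<Rightarrow> _ \<Rightarrow> _" where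
  "tgt_br p q = (fst p ** fst q - fst q ** fst p, \<lambda>i. 0)"

text \<open>An isomorphism of the quotient Lie algebra free_lie / I onto tgt_set n,
  expressed through the induced map on free_lie: a surjective Lie algebra
  homomorphism free_lie -> tgt_set n whose kernel is exactly I.\<close>
definition quot_iso_sl2_ab :: "'k::comm_ring_1 nc set \<Rightarrow> nat \<Rightarrow> bool" where
  "quot_iso_sl2_ab I n \<longleftrightarrow> (\<exists>\<phi>.
      \<phi> ` free_lie = tgt_set n
    \<and> (\<forall>x\<in>free_lie. \<forall>y\<in>free_lie. \<phi> (x + y) = tgt_add (\<phi> x) (\<phi> y))
    \<and> (\<forall>x\<in>free_lie. \<forall>c. \<phi> (smul c x) = tgt_smul c (\<phi> x))
    \<and> (\<forall>x\<in>free_lie. \<forall>y\<in>free_lie. \<phi> (ncbr x y) = tgt_br (\<phi> x) (\<phi> y))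
    \<and> (\<forall>x\<in>free_lie. \<phi> x = (0, \<lambda>i. 0) \<longleftrightarrow> x \<in> I))"

fun nest_br :: "'k::comm_ring_1 nc list \<Rightarrow> 'k nc" where
  "nest_br [] = 0"
| "nest_br [x] = x"
| "nest_br (x # xs) = ncbr x (nest_br xs)"

definition quot_nilpotent :: "'k::comm_ring_1 nc set \<Rightarrow> bool" where
  "quot_nilpotent I \<longleftrightarrow> (\<exists>k. \<forall>xs. length xs = k + 1 \<longrightarrow> set xs \<subseteq> free_lie \<longrightarrow> nest_br xs \<in> I)"

definition quot_dim_le :: "'k::comm_ring_1 nc set \<Rightarrow> nat \<Rightarrow> bool" where
  "quot_dim_le I d \<longleftrightarrow> (\<exists>S. finite S \<and> card S \<le> d \<and> S \<subseteq> free_lie \<and>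
      (\<forall>x\<in>free_lie. \<exists>c. x - (\<Sum>s\<in>S. smul (c s) s) \<in> I))"

end

theory Submission
  imports Defs
begin

text \<open>
  Differentiating the zero-curvature equation \<open>D\<^sub>x B - D\<^sub>t A + [A, B] = 0\<close> with respect to
  \<open>u\<^sub>5, u\<^sub>4, \<dots>\<close> shows that \<open>A = u\<^sub>0 X + Z\<close> with \<open>X\<close>, \<open>Z\<close> depending on \<open>x\<close>, \<open>t\<close> only, and expresses \<open>B\<close>
  through the iterates \<open>X\<^sub>k = \<delta>\<^sup>k X\<close> of the derivation \<open>\<delta> = \<partial>\<^sub>x + ad Z\<close>, up to a remainder \<open>H\<close>
  depending on \<open>x\<close>, \<open>t\<close>. What remains are the relations \<open>[X, [X, X\<^sub>1]] = 0\<close>, \<open>[X, X\<^sub>2] = - 4 \<alpha> X\<^sub>1\<close>,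
  \<open>5 [X\<^sub>1, X\<^sub>3] = - 2 (6 \<alpha> + \<beta>) X\<^sub>3\<close> and \<open>(\<partial>\<^sub>t + ad H) X = X\<^sub>5\<close>. Together they force
  \<open>(6 \<alpha> + \<beta>) (\<alpha> + \<beta>) (16 \<alpha> + \<beta>) X\<^sub>3 = 0\<close>. Hence outside the exceptional cases \<open>X, X\<^sub>1, X\<^sub>2\<close> and
  \<open>Y = [X, X\<^sub>1]\<close> close under the bracket, and the normalisation at \<open>a\<close> implies that their values at \<open>a\<close>
  span the quotient. For \<open>\<alpha> = 0\<close> this is a quotient of a Heisenberg algebra plus a line; for \<open>\<alpha> \<noteq> 0\<close> the
  bracket table is that of \<open>gl\<^sub>2\<close>, and a solution with values in \<open>gl\<^sub>2\<close> satisfying the normalisation,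
  obtained from one with constant \<open>X\<close> by a gauge transformation, shows that nothing collapses.
\<close>

section \<open>Identities in Lie algebras\<close>

locale lie_algebra = vector_space scale
  for scale :: "'k::field_char_0 \<Rightarrow> 'v::ab_group_add \<Rightarrow> 'v" (infixr "\<odot>" 75) +
  fixes br :: "'v \<Rightarrow> 'v \<Rightarrow> 'v"
  assumes br_add_left: "br (x + y) z = br x z + br y z"
    and br_scale_left: "br (c \<odot> x) z = c \<odot> br x z"
    and br_self [simp]: "br x x = 0"
    and br_add_right: "br z (x + y) = br z x + br z y"
    and br_scale_right: "br z (c \<odot> x) = c \<odot> br z x"
    and jacobi: "br x (br y z) = br (br x y) z + br y (br x z)"
begin

lemma br_skew: "br y x = - br x y"
proof -
  have "0 = br (x + y) (x + y)" by simp
  also have "\<dots> = br x y + br y x" by (simp add: br_add_left br_add_right del: br_self) simp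
  finally show ?thesis by (simp add: eq_neg_iff_add_eq_0 add.commute)
qed

lemma br_zero [simp]: "br 0 x = 0" "br x 0 = 0"
  using br_scale_left[of 0 0 x] br_scale_right[of x 0 0] by simp_all

lemma br_minus: "br (- x) y = - br x y" "br x (- y) = - br x y"
  using br_scale_left[of "-1" x y] br_scale_right[of x "-1" y] by simp_all

lemma br_diff: "br (x - y) z = br x z - br y z" "br z (x - y) = br z x - br z y"
  using br_add_left[of x "- y" z] br_add_right[of z x "- y"] by (simp_all add: br_minus)

lemmas br_linear = br_add_left br_add_right br_scale_left br_scale_right br_minus br_diff

definition functional :: "('v \<Rightarrow> 'k) \<Rightarrow> bool" where
  "functional f \<longleftrightarrow> (\<forall>x y. f (x + y) = f x + f y) \<and> (\<forall>c x. f (c \<odot> x) = c * f x)"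

lemma functional_simps:
  assumes "functional f"
  shows "f (x + y) = f x + f y" "f (c \<odot> x) = c * f x" "f 0 = 0" "f (- x) = - f x"
    "f (x - y) = f x - f y"
proof -
  have a: "f (x + y) = f x + f y" and s: "f (c \<odot> x) = c * f x" for x y c
    using assms by (auto simp: functional_def)
  have z: "f 0 = 0" using s[of 0 0] by simp
  have m: "f (- x) = - f x" for x using s[of "-1" x] by simp
  show "f (x + y) = f x + f y" "f (c \<odot> x) = c * f x" "f 0 = 0" "f (- x) = - f x"
    "f (x - y) = f x - f y" using a[of x "- y"] by (simp_all add: a s z m)
qed

text \<open>Functionals turn identities between linear combinations into identities in the field,
  where ring normalisation is available.\<close>
lemma functional_eqI:
  assumes "\<And>f. functional f \<Longrightarrow> f x = f y"
  shows "x = y"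
proof (rule ccontr)
  interpret p: vector_space_pair scale "(*) :: 'k \<Rightarrow> 'k \<Rightarrow> 'k"
    by unfold_locales (simp_all add: algebra_simps)
  assume "x \<noteq> y"
  then have "independent {x - y}" by simp
  from p.linear_independent_extend[OF this, of "\<lambda>_. 1"]
  obtain g where g: "Vector_Spaces.linear scale (*) g" "g (x - y) = 1" by auto
  interpret g: Vector_Spaces.linear scale "(*)" g by fact
  have "functional g" by (simp add: functional_def g.add g.scale)
  with assms[of g] g(2) show False by (simp add: functional_simps)
qed

text \<open>A known identity \<open>a = b\<close> is carried into scalar form together with the
  goal, so that field arithmetic can combine the two.\<close>

lemma functional_eqI1: "a = b \<Longrightarrow> (\<And>f. functional f \<Longrightarrow> f a = f b \<Longrightarrow> f x = f y) \<Longrightarrow> x = y"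
  using functional_eqI by blast

end

section \<open>The zero-curvature equation\<close>

text \<open>Functions of x, t, u_0, u_1, ... with values in a Lie algebra, given by rules of
  calculation alone: \<open>d k\<close> is the derivative by u_k, \<open>m k\<close> multiplication
  by u_k. The elimination takes place here and is applied to formal power series afterwards.\<close>

locale zcr_calculus = lie_algebra scale br
  for scale :: "'k::field_char_0 \<Rightarrow> 'v::ab_group_add \<Rightarrow> 'v" (infixr "\<odot>" 75)
    and br :: "'v \<Rightarrow> 'v \<Rightarrow> 'v" +
  fixes dx dt :: "'v \<Rightarrow> 'v" and d m :: "nat \<Rightarrow> 'v \<Rightarrow> 'v"
  assumes dx_add [simp]: "dx (x + y) = dx x + dx y" and dx_scale [simp]: "dx (c \<odot> x) = c \<odot> dx x"
    and dt_add [simp]: "dt (x + y) = dt x + dt y" and dt_scale [simp]: "dt (c \<odot> x) = c \<odot> dt x"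
    and d_add [simp]: "d k (x + y) = d k x + d k y" and d_scale [simp]: "d k (c \<odot> x) = c \<odot> d k x"
    and m_add [simp]: "m k (x + y) = m k x + m k y" and m_scale [simp]: "m k (c \<odot> x) = c \<odot> m k x"
    and dx_br: "dx (br x y) = br (dx x) y + br x (dx y)"
    and dt_br: "dt (br x y) = br (dt x) y + br x (dt y)"
    and d_br: "d k (br x y) = br (d k x) y + br x (d k y)"
    and br_m_left [simp]: "br (m k x) y = m k (br x y)"
    and dx_dt: "dx (dt x) = dt (dx x)"
    and d_dx [simp]: "d k (dx x) = dx (d k x)"
    and d_dt [simp]: "d k (dt x) = dt (d k x)"
    and d_d: "d k (d j x) = d j (d k x)"
    and m_m: "m k (m j x) = m j (m k x)"
    and dx_m [simp]: "dx (m k x) = m k (dx x)"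
    and dt_m [simp]: "dt (m k x) = m k (dt x)"
    and d_m [simp]: "d j (m k x) = m k (d j x) + (if j = k then x else 0)"
begin

lemma zero_ops [simp]: "dx 0 = 0" "dt 0 = 0" "d k 0 = 0" "m k 0 = 0"
  using dx_scale[of 0 0] dt_scale[of 0 0] d_scale[of k 0 0] m_scale[of k 0 0] by simp_all

lemma minus_ops [simp]: "dx (- x) = - dx x" "dt (- x) = - dt x" "d k (- x) = - d k x"
  "m k (- x) = - m k x"
  using dx_scale[of "-1" x] dt_scale[of "-1" x] d_scale[of k "-1" x] m_scale[of k "-1" x] by simp_all

lemma diff_ops [simp]: "dx (x - y) = dx x - dx y" "dt (x - y) = dt x - dt y"
  "d k (x - y) = d k x - d k y" "m k (x - y) = m k x - m k y"
  using dx_add[of x "- y"] dt_add[of x "- y"] d_add[of k x "- y"] m_add[of k x "- y"]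
  by (simp_all del: dx_add dt_add d_add m_add)

lemma br_m_right [simp]: "br x (m k y) = m k (br x y)"
  by (metis br_m_left br_skew minus_ops(4))

lemma d_d_zero [simp]: "d k x = 0 \<Longrightarrow> d k (d j x) = 0"
  by (simp add: d_d[of k])

lemma d_br_zero [simp]: "d k x = 0 \<Longrightarrow> d k y = 0 \<Longrightarrow> d k (br x y) = 0"
  by (simp add: d_br)

lemma scale_sums: "x + x = 2 \<odot> x" "x + c \<odot> x = (1 + c) \<odot> x" "c \<odot> x + x = (c + 1) \<odot> x"
  "b \<odot> x + c \<odot> x = (b + c) \<odot> x"
  using scale_left_distrib[of 1 1 x] by (simp_all add: scale_left_distrib)

text \<open>Comparison of coefficients in u_k: repeated differentiation isolates the top coefficient
  up to a factorial, which characteristic 0 cancels. Degree 3 covers every polynomial that arises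
  below.\<close>

lemma m_polynomial_zero:
  assumes d: "d k x\<^sub>0 = 0" "d k x\<^sub>1 = 0" "d k x\<^sub>2 = 0" "d k x\<^sub>3 = 0"
    and p: "x\<^sub>0 + m k x\<^sub>1 + m k (m k x\<^sub>2) + m k (m k (m k x\<^sub>3)) = 0"
  shows "x\<^sub>0 = 0 \<and> x\<^sub>1 = 0 \<and> x\<^sub>2 = 0 \<and> x\<^sub>3 = 0"
proof -
  have nz: "n \<odot> x = 0 \<Longrightarrow> n \<noteq> 0 \<Longrightarrow> x = 0" for n x by simp
  from arg_cong[OF p, of "\<lambda>x. d k (d k (d k x))"]
  have "6 \<odot> x\<^sub>3 = 0" by (simp add: d add.assoc scale_sums)
  then have x3: "x\<^sub>3 = 0" by simp
  from arg_cong[OF p, of "\<lambda>x. d k (d k x)"] x3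
  have "2 \<odot> x\<^sub>2 = 0" by (simp add: d scale_sums)
  then have x2: "x\<^sub>2 = 0" by simp
  from arg_cong[OF p, of "d k"] x3 x2
  have x1: "x\<^sub>1 = 0" by (simp add: d)
  show ?thesis using p x1 x2 x3 by simp
qed

end

section \<open>Elimination of u_5, ..., u_1 from the zero-curvature equation\<close>

locale zcr = zcr_calculus scale br dx dt d m
  for scale :: "'k::field_char_0 \<Rightarrow> 'v::ab_group_add \<Rightarrow> 'v" (infixr "\<odot>" 75)
    and br :: "'v \<Rightarrow> 'v \<Rightarrow> 'v" and dx dt d m +
  fixes \<alpha> \<beta> :: 'k and A B :: 'v
  assumes d_A: "1 \<le> k \<Longrightarrow> d k A = 0" and d_B: "5 \<le> k \<Longrightarrow> d k B = 0"
    and zcr: "dx B + m 1 (d 0 B) + m 2 (d 1 B) + m 3 (d 2 B) + m 4 (d 3 B) + m 5 (d 4 B) + br A B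
      = dt A + m 5 (d 0 A) + (4 * \<alpha> - 6 * \<beta>) \<odot> m 1 (m 2 (d 0 A))
        + (8 * \<alpha> - 2 * \<beta>) \<odot> m 0 (m 3 (d 0 A)) - (20 * \<alpha> * \<beta>) \<odot> m 0 (m 0 (m 1 (d 0 A)))"
begin

text \<open>The part of the covariant derivative D_x + ad A without the terms u_(k+1)
  \<open>d k\<close>. It commutes with \<open>d k\<close> for k >= 1 because \<open>A\<close>
  depends on no u_k but u_0; for \<open>d 0\<close> the correction ad P appears in
  \<open>d0_E\<close>.\<close>

definition E :: "'v \<Rightarrow> 'v" where "E x = dx x + br A x"

lemma E_ops [simp]: "E (x + y) = E x + E y" "E (x - y) = E x - E y" "E (- x) = - E x"
  "E (c \<odot> x) = c \<odot> E x" "E 0 = 0" "E (m k x) = m k (E x)"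
  by (simp_all add: E_def br_linear scale_right_distrib)

lemma E_br: "E (br x y) = br (E x) y + br x (E y)"
  using jacobi[of A x y] by (simp add: E_def dx_br br_linear)

lemma d_E [simp]: "1 \<le> k \<Longrightarrow> d k (E x) = E (d k x)"
  by (simp add: E_def d_br d_A)

abbreviation "P \<equiv> d 0 A"

lemma d0_E: "d 0 (E x) = E (d 0 x) + br P x"
  by (simp add: E_def d_br)

lemma d_P [simp]: "1 \<le> k \<Longrightarrow> d k P = 0"
  by (simp add: d_A)

abbreviation "c \<equiv> 8 * \<alpha> - 2 * \<beta>"
abbreviation "c' \<equiv> 4 * \<alpha> - 6 * \<beta>"
abbreviation "g \<equiv> 20 * \<alpha> * \<beta>"

lemma d4_B: "d 4 B = P"
proof -
  from arg_cong[OF zcr, of "d 5"] show ?thesis by (simp add: d_A d_B)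
qed

text \<open>The derivations \<open>d 5, d 4, \<dots>, d 1\<close> applied in turn to the equation determine the dependence
  of \<open>B\<close> on the highest remaining variable; \<open>B\<^sub>k\<close> is what is left, free of \<open>u\<^sub>j\<close> for \<open>j > k\<close>.\<close>
definition "B\<^sub>3 = B - m 4 P"
definition "S = E P + m 1 (d 0 P)"

lemma d_B3 [simp]: "4 \<le> k \<Longrightarrow> d k B\<^sub>3 = 0"
  by (cases "k = 4") (simp_all add: B\<^sub>3_def d4_B d_B)

lemma zcr3: "E B\<^sub>3 + m 1 (d 0 B\<^sub>3) + m 2 (d 1 B\<^sub>3) + m 3 (d 2 B\<^sub>3) + m 4 (d 3 B\<^sub>3) + m 4 S
      = dt A + c' \<odot> m 1 (m 2 P) + c \<odot> m 0 (m 3 P) - g \<odot> m 0 (m 0 (m 1 P))"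
proof -
  have "E B + m 1 (d 0 B) + m 2 (d 1 B) + m 3 (d 2 B) + m 4 (d 3 B)
      = dt A + c' \<odot> m 1 (m 2 (d 0 A))
        + c \<odot> m 0 (m 3 (d 0 A)) - g \<odot> m 0 (m 0 (m 1 (d 0 A)))"
    using zcr by (simp add: E_def d4_B algebra_simps)
  then show ?thesis unfolding B\<^sub>3_def S_def
    by (simp add: m_m algebra_simps)
qed

lemma d3_B3: "d 3 B\<^sub>3 = - S"
proof -
  have S4: "d 4 S = 0" by (simp add: S_def)
  from arg_cong[OF zcr3, of "d 4"] show ?thesis by (simp add: d_A S4 eq_neg_iff_add_eq_0)
qed

definition "B\<^sub>2 = B\<^sub>3 + m 3 S"

lemma d_S [simp]: "2 \<le> k \<Longrightarrow> d k S = 0" "d 1 S = d 0 P" "d (Suc 0) S = d 0 P"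
  by (simp_all add: S_def)

lemma d_B2 [simp]: "3 \<le> k \<Longrightarrow> d k B\<^sub>2 = 0"
  by (cases "k = 3") (simp_all add: B\<^sub>2_def d3_B3)

lemma zcr2: "E B\<^sub>2 + m 1 (d 0 B\<^sub>2) + m 2 (d 1 B\<^sub>2) + m 3 (d 2 B\<^sub>2)
      - m 3 (E S + m 1 (d 0 S) + m 2 (d 0 P))
      = dt A + c' \<odot> m 1 (m 2 P) + c \<odot> m 0 (m 3 P) - g \<odot> m 0 (m 0 (m 1 P))"
proof -
  have "E B\<^sub>3 + m 1 (d 0 B\<^sub>3) + m 2 (d 1 B\<^sub>3) + m 3 (d 2 B\<^sub>3)
      = dt A + c' \<odot> m 1 (m 2 P) + c \<odot> m 0 (m 3 P) - g \<odot> m 0 (m 0 (m 1 P))"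
    using zcr3 by (simp add: d3_B3)
  then show ?thesis unfolding B\<^sub>2_def
    by (simp add: m_m algebra_simps)
qed

text \<open>This is (D_x + ad A) S without its term u_2 \<open>d 0 P\<close>, which is carried
  separately to keep \<open>S\<^sub>2\<close> free of u_2.\<close>

definition "S\<^sub>2 = E S + m 1 (d 0 S)"

lemma d2_B2: "d 2 B\<^sub>2 = S\<^sub>2 + m 2 (d 0 P) + c \<odot> m 0 P"
proof -
  from arg_cong[OF zcr2, of "d 3"] show ?thesis by (simp add: d_A S\<^sub>2_def algebra_simps)
qed

definition "B\<^sub>1 = B\<^sub>2 - m 2 S\<^sub>2 - (1/2) \<odot> m 2 (m 2 (d 0 P)) - c \<odot> m 2 (m 0 P)"

lemma d_S2 [simp]: "2 \<le> k \<Longrightarrow> d k S\<^sub>2 = 0"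
  by (simp_all add: S\<^sub>2_def)

lemma half_double: "(1/2) \<odot> (x + x) = x"
  by (simp flip: scale_left_distrib add: scale_right_distrib)

lemma d_B1 [simp]: "2 \<le> k \<Longrightarrow> d k B\<^sub>1 = 0"
  by (cases "k = 2") (simp_all add: B\<^sub>1_def d2_B2 half_double)

lemma zcr1: "E B\<^sub>1 + m 1 (d 0 B\<^sub>1) + m 2 (d 1 B\<^sub>1) + m 2 (E S\<^sub>2 + m 1 (d 0 S\<^sub>2) + m 2 (d 1 S\<^sub>2))
   + (1/2) \<odot> m 2 (m 2 (E (d 0 P) + m 1 (d 0 (d 0 P))))
   + c \<odot> m 2 (m 0 (E P) + m 1 P + m 1 (m 0 (d 0 P)))
      = dt A + c' \<odot> m 1 (m 2 P) - g \<odot> m 0 (m 0 (m 1 P))"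
proof -
  have "m 3 (d 2 B\<^sub>2) = m 3 (E S + m 1 (d 0 S) + m 2 (d 0 P)) + c \<odot> m 0 (m 3 P)"
    by (simp add: d2_B2 S\<^sub>2_def m_m)
  with zcr2 have "E B\<^sub>2 + m 1 (d 0 B\<^sub>2) + m 2 (d 1 B\<^sub>2)
      = dt A + c' \<odot> m 1 (m 2 P) - g \<odot> m 0 (m 0 (m 1 P))" by simp
  then show ?thesis unfolding B\<^sub>1_def
    by (simp add: m_m algebra_simps)
qed

text \<open>The coefficient of u_2^2 in \<open>zcr1\<close> is 5/2 times this expression:
  \<open>d 1 S\<^sub>2\<close> contributes 2, the quadratic term split off from
  \<open>B\<^sub>2\<close> contributes 1/2.\<close>

lemma zcr1_d2: "E (d 0 P) + m 1 (d 0 (d 0 P)) = 0"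
proof -
  let ?T = "E (d 0 P) + m 1 (d 0 (d 0 P))"
  have S2: "d 1 S\<^sub>2 = 2 \<odot> ?T"
    by (simp add: S\<^sub>2_def S_def d0_E scale_sums algebra_simps)
  from arg_cong[OF zcr1, of "\<lambda>x. d 2 (d 2 x)"]
  have "2 \<odot> d 1 S\<^sub>2 + ?T = 0"
    by (simp add: d_A scale_sums scale_right_distrib)
  then have "5 \<odot> ?T = 0" by (simp only: S2 scale_scale scale_sums) simp
  then show ?thesis by (simp only: scale_eq_0_iff) simp
qed

text \<open>\<open>E (d 0 P)\<close> is free of u_1, so the derivative of \<open>zcr1_d2\<close> by
  u_1 leaves the second summand alone. Thus \<open>A\<close> is at most quadratic in u_0.\<close>

lemma ddP [simp]: "d 0 (d 0 P) = 0"
  using arg_cong[OF zcr1_d2, of "d 1"] by simp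

lemma E_dP [simp]: "E (d 0 P) = 0"
  using zcr1_d2 by simp

lemma br_P_dP [simp]: "br P (d 0 P) = 0"
  using arg_cong[OF E_dP, of "d 0"] by (simp add: d0_E del: E_dP)

lemma d0_EP [simp]: "d 0 (E P) = 0"
  by (simp add: d0_E)

lemma br_dP_EP [simp]: "br (d 0 P) (E P) = 0"
  using arg_cong[OF br_P_dP, of E] br_skew[of "E P" "d 0 P"] by (simp add: E_br del: br_P_dP)

lemma d0_S: "d 0 S = 0"
  by (simp add: S_def)

lemma S2: "S\<^sub>2 = E S"
  by (simp add: S\<^sub>2_def d0_S)

lemma d0_S2: "d 0 S\<^sub>2 = br P (E P)"
  by (simp add: S2 d0_E d0_S) (simp add: S_def br_linear)

lemma d1_S2 [simp]: "d (Suc 0) S\<^sub>2 = 0"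
  by (simp add: S2)

text \<open>The added terms cancel the antiderivative in u_1 of the right-hand side of
  \<open>d1_B1\<close>.\<close>

definition "B\<^sub>0 = B\<^sub>1 + m 1 (E S\<^sub>2 + c \<odot> m 0 (E P))
  + (1/2) \<odot> m 1 (m 1 (br P (E P) + (c - c') \<odot> P + c \<odot> m 0 (d 0 P)))"

lemma d1_B1: "d (Suc 0) B\<^sub>1 = - E S\<^sub>2 - c \<odot> m 0 (E P)
  - m 1 (br P (E P) + (c - c') \<odot> P + c \<odot> m 0 (d 0 P))"
proof -
  from arg_cong[OF zcr1, of "d 2"]
  have "d 1 B\<^sub>1 + (E S\<^sub>2 + m 1 (d 0 S\<^sub>2)) + c \<odot> (m 0 (E P) + m 1 P + m 1 (m 0 (d 0 P))) = c' \<odot> m 1 P"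
    by (simp add: d_A add.assoc)
  then show ?thesis
    by (rule functional_eqI1) (simp add: functional_simps d0_S2 algebra_simps)
qed

lemma d_B0 [simp]: "1 \<le> k \<Longrightarrow> d k B\<^sub>0 = 0"
proof (cases "k = 1")
  case True
  from d1_B1 show ?thesis unfolding True
    by (rule functional_eqI1) (simp add: B\<^sub>0_def functional_simps field_simps)
qed (simp add: B\<^sub>0_def)

text \<open>In terms of \<open>B\<^sub>0\<close> the equation is a cubic in u_1 with coefficients
  free of u_1; the four equations are its coefficients of degree 0 to 3.\<close>

lemma zcr0:
  "E B\<^sub>0 = dt A" (is ?th0)
  "d 0 B\<^sub>0 = E (E S\<^sub>2) + c \<odot> m 0 (E (E P)) - g \<odot> m 0 (m 0 P)" (is ?th1)
  "d 0 (E S\<^sub>2) + c \<odot> E P + (1/2) \<odot> (E (br P (E P)) + (c - c') \<odot> E P) = 0" (is ?th2)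
  "(2 * c - c') \<odot> d 0 P = 0" (is ?th3)
proof -
  have "E B\<^sub>1 + m 1 (d 0 B\<^sub>1) + m 2 (d 1 B\<^sub>1) + m 2 (E S\<^sub>2 + m 1 (br P (E P)))
     + c \<odot> m 2 (m 0 (E P) + m 1 P + m 1 (m 0 (d 0 P)))
      = dt A + c' \<odot> m 1 (m 2 P) - g \<odot> m 0 (m 0 (m 1 P))"
    using zcr1 by (simp add: d0_S2)
  then have h: "E B\<^sub>1 + m 1 (d 0 B\<^sub>1) = dt A - g \<odot> m 0 (m 0 (m 1 P))"
    by (rule functional_eqI1) (simp add: d1_B1 functional_simps algebra_simps m_m)
  have "(dt A - E B\<^sub>0) + m 1 (E (E S\<^sub>2) + c \<odot> m 0 (E (E P)) - g \<odot> m 0 (m 0 P) - d 0 B\<^sub>0)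
    + m 1 (m 1 (d 0 (E S\<^sub>2) + c \<odot> E P + (1/2) \<odot> (E (br P (E P)) + (c - c') \<odot> E P)))
    + m 1 (m 1 (m 1 ((1/2) \<odot> (2 * c - c') \<odot> d 0 P))) = 0"
    using h by (rule functional_eqI1)
      (simp add: B\<^sub>0_def d_br functional_simps m_m field_simps)
  from m_polynomial_zero[OF _ _ _ _ this]
  show ?th0 ?th1 ?th2 ?th3
    by (simp_all add: d_A d_br)
qed

end

section \<open>Reduction to functions of x and t when A is affine in u_0\<close>

locale zcr_generic = zcr scale br dx dt d m \<alpha> \<beta> A B
  for scale :: "'k::field_char_0 \<Rightarrow> 'v::ab_group_add \<Rightarrow> 'v" (infixr "\<odot>" 75)
    and br :: "'v \<Rightarrow> 'v \<Rightarrow> 'v" and dx dt d m \<alpha> \<beta> A B +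
  assumes not_kdv: "6 * \<alpha> + \<beta> \<noteq> 0"
begin

lemma dP [simp]: "d 0 P = 0"
proof -
  \<comment> \<open>For nonzero \<alpha> the excluded case 6\<alpha> + \<beta> = 0 is the
    fifth-order KdV equation up to scaling of u.\<close>
  have "2 * c - c' = 2 * (6 * \<alpha> + \<beta>)" by (simp add: algebra_simps)
  then have "2 * c - c' \<noteq> 0" using not_kdv by (simp only: mult_eq_0_iff) simp
  with zcr0(4) show ?thesis by (simp only: scale_eq_0_iff) simp
qed

lemma d_P_all [simp]: "d k P = 0"
  by (cases "k = 0") simp_all

definition "Z = A - m 0 P"

lemma d_Z [simp]: "d k Z = 0"
  by (cases "k = 0") (simp_all add: Z_def d_A)

text \<open>The u_0-free part of \<open>E\<close>: by \<open>E_eq\<close>, \<open>E\<close> is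
  \<delta> plus u_0 times ad P. Unlike \<open>E\<close>, it commutes with all
  \<open>d k\<close>.\<close>

definition "\<delta> x = dx x + br Z x"

lemma \<delta>_ops [simp]: "\<delta> (x + y) = \<delta> x + \<delta> y" "\<delta> (x - y) = \<delta> x - \<delta> y" "\<delta> (- x) = - \<delta> x"
  "\<delta> (r \<odot> x) = r \<odot> \<delta> x" "\<delta> 0 = 0" "\<delta> (m k x) = m k (\<delta> x)" "d k (\<delta> x) = \<delta> (d k x)"
  by (simp_all add: \<delta>_def br_linear scale_right_distrib d_br)

lemma \<delta>_br: "\<delta> (br x y) = br (\<delta> x) y + br x (\<delta> y)"
  using jacobi[of Z x y] by (simp add: \<delta>_def dx_br br_linear)

lemma E_eq: "E x = \<delta> x + m 0 (br P x)"
  by (simp add: E_def \<delta>_def Z_def br_linear)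

definition "X k = (\<delta> ^^ k) P"

lemma X0: "P = X 0" and \<delta>_X [simp]: "\<delta> (X k) = X (Suc k)"
  by (simp_all add: X_def)

lemma d_X [simp]: "d k (X j) = 0"
  by (induction j) (simp_all flip: \<delta>_X X0)

definition "Y = br (X 0) (X 1)"

lemma br_X0_X1: "br (X 0) (X (Suc 0)) = Y"
  by (simp add: Y_def)

lemma d_Y [simp]: "d k Y = 0"
  by (simp add: Y_def)

lemma S2_eq: "S\<^sub>2 = X 2 + m 0 Y"
  by (simp add: S2 S_def E_eq X0 Y_def numeral_2_eq_2)

lemma \<delta>_Y: "\<delta> Y = br (X 0) (X 2)"
  by (simp add: Y_def \<delta>_br numeral_2_eq_2)

text \<open>These are the two coefficients in u_0 of the u_1^2 equation of \<open>zcr0\<close>.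
  There \<beta> cancels, since c + (c - c')/2 = 10\<alpha>.\<close>

lemma relations: "br (X 0) (X 2) = - (4 * \<alpha>) \<odot> X 1" "br (X 0) Y = 0"
proof -
  \<comment> \<open>The zero summands bring a linear polynomial into the cubic shape of
    \<open>m_polynomial_zero\<close>.\<close>
  have "((5/2) \<odot> br (X 0) (X 2) + (10 * \<alpha>) \<odot> X 1) + m 0 ((5/2) \<odot> br (X 0) Y)
    + m 0 (m 0 0) + m 0 (m 0 (m 0 0)) = 0"
    using zcr0(3)
    by (rule functional_eqI1)
      (simp add: E_eq S2_eq X0 d_br functional_simps br_linear \<delta>_Y br_X0_X1 field_simps)
  from m_polynomial_zero[OF _ _ _ _ this]
  have *: "(5/2) \<odot> br (X 0) (X 2) + (10 * \<alpha>) \<odot> X 1 = 0" and "br (X 0) Y = 0"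
    by (simp_all add: d_br)
  then show "br (X 0) Y = 0" by simp
  from * show "br (X 0) (X 2) = - (4 * \<alpha>) \<odot> X 1"
    by (rule functional_eqI1) (simp only: functional_simps, algebra)
qed

lemma \<delta>_Y': "\<delta> Y = - (4 * \<alpha>) \<odot> X 1"
  by (simp add: \<delta>_Y relations)

lemma E_S2: "E S\<^sub>2 = X 3 - (8 * \<alpha>) \<odot> m 0 (X 1)"
  by (rule functional_eqI)
    (simp add: S2_eq E_eq X0 br_linear relations \<delta>_Y' functional_simps numeral_2_eq_2[symmetric])

text \<open>\<open>K\<^sub>1\<close> and \<open>K\<^sub>2\<close> are the coefficients of u_0 and
  u_0^2 in \<open>d 0 B\<^sub>0\<close>, see \<open>d0_B0\<close>.\<close>

definition "K\<^sub>1 = - (2 * \<beta>) \<odot> X 2 + br (X 0) (X 3)"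
definition "K\<^sub>2 = - (2 * \<beta>) \<odot> Y - g \<odot> X 0"

lemma d_K [simp]: "d k K\<^sub>1 = 0" "d k K\<^sub>2 = 0"
  by (simp_all add: K\<^sub>1_def K\<^sub>2_def d_br)

lemma d0_B0: "d 0 B\<^sub>0 = X 4 + m 0 K\<^sub>1 + m 0 (m 0 K\<^sub>2)"
proof -
  have EP: "E (E P) = X 2 + m 0 Y"
    by (simp add: E_eq X0 br_X0_X1 numeral_2_eq_2[symmetric])
  have ES2: "E (E S\<^sub>2) = X 4 + m 0 (br (X 0) (X 3)) - (8 * \<alpha>) \<odot> m 0 (X 2) - (8 * \<alpha>) \<odot> m 0 (m 0 Y)"
    by (rule functional_eqI)
      (simp add: E_S2, simp add: E_eq X0 br_linear br_X0_X1 functional_simps algebra_simps numeral_2_eq_2[symmetric])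
  show ?thesis
    using zcr0(2)[unfolded EP ES2]
    by (rule functional_eqI1) (simp add: K\<^sub>1_def K\<^sub>2_def functional_simps algebra_simps, simp add: X0)
qed

definition "H = B\<^sub>0 - m 0 (X 4) - (1/2) \<odot> m 0 (m 0 K\<^sub>1) - (1/3) \<odot> m 0 (m 0 (m 0 K\<^sub>2))"

lemma d_H [simp]: "d k H = 0"
proof (cases "k = 0")
  case True
  show ?thesis unfolding True
    by (rule functional_eqI) (simp add: H_def d0_B0 functional_simps field_simps)
qed (simp add: H_def)

text \<open>Coefficients in u_0 of \<open>E B\<^sub>0 = dt A\<close>. The constant one is the
  zero-curvature equation of the pair Z, H, which makes \<open>D\<close> and \<delta> commute; the
  linear one says that X evolves by the linear part u_t = u_5 of the equation, with covariant
  derivatives.\<close>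

lemma zcr_H: "\<delta> H = dt Z" "dt (X 0) = X 5 + br (X 0) H"
  "(1/2) \<odot> \<delta> K\<^sub>1 + br (X 0) (X 4) = 0"
proof -
  have K2: "br (X 0) K\<^sub>2 = 0" by (simp add: K\<^sub>2_def br_linear relations)
  have "(\<delta> H - dt Z) + m 0 (X 5 + br (X 0) H - dt (X 0))
    + m 0 (m 0 ((1/2) \<odot> \<delta> K\<^sub>1 + br (X 0) (X 4)))
    + m 0 (m 0 (m 0 ((1/3) \<odot> \<delta> K\<^sub>2 + (1/2) \<odot> br (X 0) K\<^sub>1))) = 0"
    using zcr0(1)
    by (rule functional_eqI1)
      (simp add: H_def Z_def E_eq X0 br_linear K2 functional_simps field_simps)
  from m_polynomial_zero[OF _ _ _ _ this]
  show "\<delta> H = dt Z" "dt (X 0) = X 5 + br (X 0) H" "(1/2) \<odot> \<delta> K\<^sub>1 + br (X 0) (X 4) = 0"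
    by (simp_all add: d_br)
qed

definition "D x = dt x + br H x"

lemma D_ops [simp]: "D (x + y) = D x + D y" "D (x - y) = D x - D y" "D (- x) = - D x"
  "D (r \<odot> x) = r \<odot> D x" "D 0 = 0"
  by (simp_all add: D_def br_linear scale_right_distrib)

lemma D_br: "D (br x y) = br (D x) y + br x (D y)"
  using jacobi[of H x y] by (simp add: D_def dt_br br_linear)

lemma D_\<delta>: "D (\<delta> x) = \<delta> (D x)"
  using jacobi[of Z H x] zcr_H(1)
  by (simp add: D_def \<delta>_def dt_br dx_br br_linear dx_dt algebra_simps flip: br_add_left)

lemma D_X: "D (X k) = X (k + 5)"
proof (induction k)
  case 0
  show ?case using br_skew[of "X 0" H] by (simp add: D_def zcr_H(2))
next
  case (Suc k)
  then show ?case using D_\<delta>[of "X k"] by simp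
qed

end

section \<open>Vanishing of X 3 outside the Sawada-Kotera and Kaup-Kupershmidt cases\<close>

locale zcr_nonexceptional = zcr_generic scale br dx dt d m \<alpha> \<beta> A B
  for scale :: "'k::field_char_0 \<Rightarrow> 'v::ab_group_add \<Rightarrow> 'v" (infixr "\<odot>" 75)
    and br :: "'v \<Rightarrow> 'v \<Rightarrow> 'v" and dx dt d m \<alpha> \<beta> A B +
  assumes not_sk: "\<alpha> + \<beta> \<noteq> 0" and not_kk: "16 * \<alpha> + \<beta> \<noteq> 0"
begin

definition "\<kappa> = - (2/5) * (6 * \<alpha> + \<beta>)"

lemma br_X0_X3: "br (X 0) (X 3) = - (4 * \<alpha>) \<odot> X 2 - br (X 1) (X 2)"
proof -
  have "\<delta> (br (X 0) (X 2)) = - (4 * \<alpha>) \<odot> X 2"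
    by (simp add: relations numeral_2_eq_2[symmetric])
  then show ?thesis by (simp add: \<delta>_br algebra_simps)
qed

lemma br_X0_X4: "br (X 0) (X 4) = - (4 * \<alpha>) \<odot> X 3 - 2 \<odot> br (X 1) (X 3)"
proof -
  have "\<delta> (br (X 0) (X 3)) = - (4 * \<alpha>) \<odot> X 3 - br (X 1) (X 3)"
    by (simp add: br_X0_X3 \<delta>_br numeral_2_eq_2[symmetric])
  then show ?thesis by (simp add: \<delta>_br algebra_simps scale_sums)
qed

text \<open>Two applications of \<delta> to [X_0, X_2] = -4\<alpha> X_1 express [X_0, X_4] by X_3
  and [X_1, X_3]. Inserted into the last equation of \<open>zcr_H\<close>, this leaves X_3 and
  [X_1, X_3] only.\<close>

lemma br_X1_X3: "br (X (Suc 0)) (X 3) = \<kappa> \<odot> X 3"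
proof -
  have "\<delta> K\<^sub>1 = - (2 * \<beta>) \<odot> X 3 + br (X 1) (X 3) + br (X 0) (X 4)"
    by (simp add: K\<^sub>1_def \<delta>_br)
  from zcr_H(3)[unfolded this br_X0_X4] show ?thesis
    by (rule functional_eqI1) (simp only: \<kappa>_def functional_simps One_nat_def, algebra)
qed

text \<open>Every \<open>X k\<close> commutes with \<open>N\<close>, hence also with \<open>D N = - 5 \<odot> \<delta> Q\<close>. Evaluating
  \<open>br (X 0) (br (X 1) Q)\<close> in two ways then leaves a multiple of \<open>X 3\<close> whose coefficient
  vanishes exactly for the excluded parameters.\<close>
definition "N = (4 * \<alpha>) \<odot> X 0 + Y"

lemma \<delta>_N: "\<delta> N = 0"
  by (simp add: N_def \<delta>_Y')

text \<open>As \<open>\<delta> N = 0\<close>, applying \<delta> to [X_k, N] = 0 raises k by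
  one.\<close>

lemma X_N: "br (X k) N = 0"
proof (induction k)
  case 0
  show ?case by (simp add: N_def br_linear relations)
next
  case (Suc k)
  from arg_cong[OF this, of \<delta>] show ?case by (simp add: \<delta>_br \<delta>_N)
qed

lemma Y_eq: "Y = N - (4 * \<alpha>) \<odot> X 0"
  by (simp add: N_def)

lemma N_X: "br N (X k) = 0"
  using X_N[of k] br_skew[of N "X k"] by simp

lemma br_Y_X: "br Y (X k) = - (4 * \<alpha>) \<odot> br (X 0) (X k)"
  by (simp add: Y_eq br_linear N_X)

definition "Q = br (X 1) (X 4)"

text \<open>The fourth \<delta>-derivative of [X_0, X_2] + 4\<alpha> X_1 = 0 reads [X_0, X_6] + 4
  [X_1, X_5] + 5 [X_2, X_4] + 4\<alpha> X_5 = 0. It turns D N into -5 ([X_2, X_4] + [X_1, X_5]), a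
  \<delta>-derivative.\<close>

lemma D_N: "D N = - 5 \<odot> \<delta> Q"
proof -
  have D: "D N = (4 * \<alpha>) \<odot> X 5 + br (X 5) (X 1) + br (X 0) (X 6)"
    by (simp add: N_def Y_def D_br D_X)
  have "\<delta> (\<delta> (\<delta> (\<delta> (br (X 0) (X 2) + (4 * \<alpha>) \<odot> X 1)))) = 0"
    by (simp only: relations) simp
  then show ?thesis unfolding D
    by (rule functional_eqI1)
      (simp add: Q_def \<delta>_br functional_simps br_skew[of "X 3" "X 2"] br_skew[of "X 2" "X 4"]
        br_skew[of "X (Suc 0)" "X 5"] numeral_2_eq_2[symmetric] algebra_simps)
qed

lemma X0_\<delta>Q: "br (X 0) (\<delta> Q) = 0"
proof -
  have "br (X 0) (D N) = 0" using D_br[of "X 0" N] by (simp add: D_X X_N)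
  then show ?thesis by (simp add: D_N br_linear)
qed

text \<open>Jacobi splits [X_0, [X_1, X_4]] into [Y, X_4] and [X_1, [X_0, X_4]]. On X_4 the element
  Y acts as -4\<alpha> X_0 by \<open>br_Y_X\<close>, and both terms become multiples of X_3.\<close>

lemma X0_Q: "br (X 0) Q = ((4 * \<alpha> + 2 * \<kappa>) * (4 * \<alpha> - \<kappa>)) \<odot> X 3"
  unfolding Q_def jacobi[of "X 0"]
  by (rule functional_eqI)
    (simp add: br_X1_X3 br_X0_X1 br_Y_X br_X0_X4 br_linear functional_simps algebra_simps)

lemma X1_Q: "br (X (Suc 0)) Q = ((4 * \<alpha> + 2 * \<kappa>) * (4 * \<alpha> - \<kappa>)) \<odot> X 4"
  using arg_cong[OF X0_Q, of \<delta>] by (simp add: \<delta>_br X0_\<delta>Q)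

lemma N_Q: "br N Q = 0"
  using jacobi[of N "X 1" "X 4"] by (simp add: Q_def N_X)

lemma X3_zero: "X 3 = 0"
proof -
  let ?k = "(4 * \<alpha> + 2 * \<kappa>) * (4 * \<alpha> - \<kappa>)"
  have Y: "br Y Q = - (4 * \<alpha>) \<odot> br (X 0) Q" by (simp add: Y_eq br_linear N_Q)
  \<comment> \<open>The two values of [X_0, [X_1, Q]] are -(4\<alpha> + 2\<kappa>) k X_3 and
    (\<kappa> - 4\<alpha>) k X_3. Their difference has the factors \<kappa>, 4\<alpha> + 2\<kappa>
    and 4\<alpha> - \<kappa>, one for each excluded parameter relation.\<close>
  have "(3 * \<kappa> * ?k) \<odot> X 3 = 0"
    using jacobi[of "X 0" "X 1" Q]
    by (rule functional_eqI1)
      (simp add: br_X0_X1 Y X1_Q X0_Q br_X0_X4 br_X1_X3 br_linear functional_simps, algebra)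
  moreover have "\<kappa> \<noteq> 0" unfolding \<kappa>_def using not_kdv by (simp only: mult_eq_0_iff) simp
  moreover have "4 * \<alpha> + 2 * \<kappa> \<noteq> 0"
  proof -
    have "4 * \<alpha> + 2 * \<kappa> = - (4/5) * (\<alpha> + \<beta>)" by (simp add: \<kappa>_def field_simps)
    then show ?thesis using not_sk by (simp only: mult_eq_0_iff) simp
  qed
  moreover have "4 * \<alpha> - \<kappa> \<noteq> 0"
  proof -
    have "4 * \<alpha> - \<kappa> = (2/5) * (16 * \<alpha> + \<beta>)" by (simp add: \<kappa>_def field_simps)
    then show ?thesis using not_kk by (simp only: mult_eq_0_iff) simp
  qed
  ultimately show ?thesis by (simp only: scale_eq_0_iff mult_eq_0_iff) simp
qed

lemma X_zero: "3 \<le> k \<Longrightarrow> X k = 0"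
proof (induction k rule: dec_induct)
  case base
  show ?case by (rule X3_zero)
next
  case (step k)
  then show ?case using \<delta>_X[of k] by simp
qed

text \<open>\<open>D_X\<close> shifts the index by 5, past the last nonzero X_k: all four fields are
  covariantly constant in t.\<close>

lemma D_zero: "D (X k) = 0" "D Y = 0"
  using X_zero by (simp_all add: D_X D_br Y_def)

lemma brackets:
  "br (X 0) (X 1) = Y" "br (X 0) (X 2) = - (4 * \<alpha>) \<odot> X 1" "br (X 0) Y = 0"
  "br (X 1) (X 2) = - (4 * \<alpha>) \<odot> X 2" "br (X 1) Y = (4 * \<alpha>) \<odot> Y"
  "br (X 2) Y = - (16 * \<alpha>\<^sup>2) \<odot> X 1"
proof -
  show "br (X 1) Y = (4 * \<alpha>) \<odot> Y" "br (X 2) Y = - (16 * \<alpha>\<^sup>2) \<odot> X 1"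
    using br_Y_X[of 1] br_Y_X[of 2] br_skew[of "X 1" Y] br_skew[of "X 2" Y]
    by (simp_all add: br_X0_X1 relations power2_eq_square)
  show "br (X 1) (X 2) = - (4 * \<alpha>) \<odot> X 2"
    using br_X0_X3 by (simp add: X3_zero)
qed (simp_all add: relations br_X0_X1)

lemma B_eq: "B = m 4 (X 0) - m 3 (X 1) + m 2 (X 2 + m 0 Y) + (8 * \<alpha> - 2 * \<beta>) \<odot> m 0 (m 2 (X 0))
   + (2 * \<beta>) \<odot> m 0 (m 1 (X 1)) - (1/2) \<odot> m 1 (m 1 (Y + (4 * \<alpha> + 4 * \<beta>) \<odot> X 0))
   - \<beta> \<odot> m 0 (m 0 (X 2)) - (1/3) \<odot> m 0 (m 0 (m 0 ((2 * \<beta>) \<odot> Y + (20 * \<alpha> * \<beta>) \<odot> X 0))) + H"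
proof -
  have EP: "E (X 0) = X 1" "E (X 2) = - (4 * \<alpha>) \<odot> m 0 (X 1)" "E Y = - (4 * \<alpha>) \<odot> X 1"
    by (simp_all add: E_eq X0 relations \<delta>_Y' X_zero)
  show ?thesis
    by (rule functional_eqI)
      (simp add: H_def B\<^sub>0_def B\<^sub>1_def B\<^sub>2_def B\<^sub>3_def K\<^sub>1_def K\<^sub>2_def S_def X0 EP X_zero br_X0_X1 m_m
        functional_simps S2_eq field_simps)
qed

lemma A_eq: "A = m 0 (X 0) + Z"
  by (simp add: Z_def X0)

end

context zcr_calculus
begin

text \<open>Converse of the elimination: fields subject to the relations found, with X_3 = 0 and a
  flat pair Z, H, solve the equation with B of the form in \<open>B_eq\<close>. The matrix model is
  built this way.\<close>

lemma zcr_model: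
  fixes \<alpha> \<beta> :: 'k and X\<^sub>0 X\<^sub>1 X\<^sub>2 Y Z H :: 'v
  assumes br: "br X\<^sub>0 X\<^sub>1 = Y" "br X\<^sub>0 X\<^sub>2 = - (4 * \<alpha>) \<odot> X\<^sub>1" "br X\<^sub>0 Y = 0"
    and d: "\<And>k. d k X\<^sub>0 = 0" "\<And>k. d k X\<^sub>1 = 0" "\<And>k. d k X\<^sub>2 = 0" "\<And>k. d k Y = 0"
      "\<And>k. d k Z = 0" "\<And>k. d k H = 0"
    and dx: "dx X\<^sub>0 = X\<^sub>1 - br Z X\<^sub>0" "dx X\<^sub>1 = X\<^sub>2 - br Z X\<^sub>1" "dx X\<^sub>2 = - br Z X\<^sub>2"
      "dx Y = - (4 * \<alpha>) \<odot> X\<^sub>1 - br Z Y" "dx H = dt Z - br Z H"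
    and dt: "dt X\<^sub>0 = - br H X\<^sub>0"
  defines "A \<equiv> m 0 X\<^sub>0 + Z"
  defines "B \<equiv> m 4 X\<^sub>0 - m 3 X\<^sub>1 + m 2 (X\<^sub>2 + m 0 Y) + (8 * \<alpha> - 2 * \<beta>) \<odot> m 0 (m 2 X\<^sub>0)
   + (2 * \<beta>) \<odot> m 0 (m 1 X\<^sub>1) - (1/2) \<odot> m 1 (m 1 (Y + (4 * \<alpha> + 4 * \<beta>) \<odot> X\<^sub>0))
   - \<beta> \<odot> m 0 (m 0 X\<^sub>2) - (1/3) \<odot> m 0 (m 0 (m 0 ((2 * \<beta>) \<odot> Y + (20 * \<alpha> * \<beta>) \<odot> X\<^sub>0))) + H"
  shows "dx B + m 1 (d 0 B) + m 2 (d 1 B) + m 3 (d 2 B) + m 4 (d 3 B) + m 5 (d 4 B) + br A B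
      = dt A + m 5 (d 0 A) + (4 * \<alpha> - 6 * \<beta>) \<odot> m 1 (m 2 (d 0 A))
        + (8 * \<alpha> - 2 * \<beta>) \<odot> m 0 (m 3 (d 0 A)) - (20 * \<alpha> * \<beta>) \<odot> m 0 (m 0 (m 1 (d 0 A)))"
proof (rule functional_eqI)
  fix f assume "functional f"
  note s = functional_simps[OF this]
  have H: "br X\<^sub>0 H = - br H X\<^sub>0" by (rule br_skew)
  show "f (dx B + m 1 (d 0 B) + m 2 (d 1 B) + m 3 (d 2 B) + m 4 (d 3 B) + m 5 (d 4 B) + br A B) =
      f (dt A + m 5 (d 0 A) + (4 * \<alpha> - 6 * \<beta>) \<odot> m 1 (m 2 (d 0 A))
        + (8 * \<alpha> - 2 * \<beta>) \<odot> m 0 (m 3 (d 0 A)) - (20 * \<alpha> * \<beta>) \<odot> m 0 (m 0 (m 1 (d 0 A))))"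
    by (simp add: A_def B_def s d dx dt br H m_m br_linear field_simps)
qed

end

section \<open>Formal power series over a Lie algebra\<close>

text \<open>Factorisations of the monomial with exponents e. For e of infinite support there are
  infinitely many and a sum over them has the default value 0, so the convolution identities must
  hold in that case too.\<close>

definition splits :: "(nat \<Rightarrow> nat) \<Rightarrow> ((nat \<Rightarrow> nat) \<times> (nat \<Rightarrow> nat)) set" where
  "splits e = {(p, q). \<forall>i. p i + q i = e i}"

lemma splits_iff: "(p, q) \<in> splits e \<longleftrightarrow> e = (\<lambda>i. p i + q i)"
  by (auto simp: splits_def fun_eq_iff)

abbreviation incr :: "nat \<Rightarrow> (nat \<Rightarrow> nat) \<Rightarrow> nat \<Rightarrow> nat" where
  "incr j e \<equiv> e(j := Suc (e j))"

abbreviation decr :: "nat \<Rightarrow> (nat \<Rightarrow> nat) \<Rightarrow> nat \<Rightarrow> nat" where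
  "decr j e \<equiv> e(j := e j - 1)"

lemma splits_incr_left:
  "(\<lambda>(p, q). (incr j p, q)) ` splits e = {(p, q). (p, q) \<in> splits (incr j e) \<and> 1 \<le> p j}" (is "?L = ?R")
proof
  show "?R \<subseteq> ?L"
  proof clarify
    fix p q assume "(p, q) \<in> splits (incr j e)" and "1 \<le> p j"
    then have "(decr j p, q) \<in> splits e" "(p, q) = (\<lambda>(p, q). (incr j p, q)) (decr j p, q)"
      by (auto simp: splits_def fun_eq_iff split: if_splits)
    then show "(p, q) \<in> ?L" by blast
  qed
qed (auto simp: splits_def)

lemma splits_swap: "prod.swap ` splits e = splits e"
  by (force simp: splits_def add.commute image_def)

lemma inj_on_incr_left: "inj_on (\<lambda>(p, q). (incr j p, q)) A"
  by (auto simp: inj_on_def fun_eq_iff) (metis Suc_inject fun_upd_apply)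

text \<open>Changing one exponent preserves finiteness, so the default value 0 occurs on both sides
  of the shift lemmas at once.\<close>

lemma finite_splits_incr: "finite (splits (incr j e)) \<longleftrightarrow> finite (splits e)"
proof
  assume "finite (splits (incr j e))"
  then have "finite ((\<lambda>(p, q). (incr j p, q)) ` splits e)"
    unfolding splits_incr_left by (rule finite_subset[rotated]) auto
  then show "finite (splits e)"
    using finite_imageD[OF _ inj_on_incr_left] by blast
next
  let ?I = "(\<lambda>(p, q). (incr j p, q)) ` splits e"
  assume "finite (splits e)"
  then have "finite (?I \<union> prod.swap ` ?I)" by simp
  moreover have "splits (incr j e) \<subseteq> ?I \<union> prod.swap ` ?I"
  proof clarify
    fix p q assume pq: "(p, q) \<in> splits (incr j e)" "(p, q) \<notin> prod.swap ` ?I"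
    from pq(1) have "p j + q j = Suc (e j)" by (simp add: splits_def)
    then have "1 \<le> p j \<or> 1 \<le> q j" by arith
    moreover have "(q, p) \<in> splits (incr j e)" using pq(1) by (simp add: splits_def add.commute)
    moreover from pq(2) have "(q, p) \<notin> ?I" by (force simp: image_def)
    ultimately show "(p, q) \<in> ?I" using pq(1) unfolding splits_incr_left by blast
  qed
  ultimately show "finite (splits (incr j e))" by (rule finite_subset[rotated])
qed

lemma sum_splits_incr_left:
  fixes f :: "(nat \<Rightarrow> nat) \<Rightarrow> (nat \<Rightarrow> nat) \<Rightarrow> 'a::ab_group_add"
  assumes "\<And>p q. p j = 0 \<Longrightarrow> f p q = 0"
  shows "(\<Sum>(p, q)\<in>splits (incr j e). f p q) = (\<Sum>(p, q)\<in>splits e. f (incr j p) q)"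
proof (cases "finite (splits e)")
  case True
  have "(\<Sum>(p, q)\<in>splits (incr j e). f p q) = (\<Sum>(p, q)\<in>(\<lambda>(p, q). (incr j p, q)) ` splits e. f p q)"
    unfolding splits_incr_left
    using True by (intro sum.mono_neutral_right) (auto simp: finite_splits_incr intro: assms)
  also have "\<dots> = (\<Sum>(p, q)\<in>splits e. f (incr j p) q)"
    by (subst sum.reindex[OF inj_on_incr_left]) (simp add: case_prod_unfold)
  finally show ?thesis .
next
  case False
  then show ?thesis using finite_splits_incr[of e j] by simp
qed

lemma sum_splits_swap: "(\<Sum>(p, q)\<in>splits e. f p q) = (\<Sum>(p, q)\<in>splits e. f q p)"
proof -
  have "(\<Sum>(p, q)\<in>splits e. f p q) = (\<Sum>(p, q)\<in>prod.swap ` splits e. f p q)" by (simp add: splits_swap)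
  also have "\<dots> = (\<Sum>(p, q)\<in>splits e. f q p)"
    by (subst sum.reindex) (auto simp: case_prod_unfold)
  finally show ?thesis .
qed

lemma sum_splits_incr_right:
  fixes f :: "(nat \<Rightarrow> nat) \<Rightarrow> (nat \<Rightarrow> nat) \<Rightarrow> 'a::ab_group_add"
  assumes "\<And>p q. q j = 0 \<Longrightarrow> f p q = 0"
  shows "(\<Sum>(p, q)\<in>splits (incr j e). f p q) = (\<Sum>(p, q)\<in>splits e. f p (incr j q))"
proof -
  have "(\<Sum>(p, q)\<in>splits (incr j e). f p q) = (\<Sum>(q, p)\<in>splits (incr j e). f p q)"
    by (rule sum_splits_swap)
  also have "\<dots> = (\<Sum>(q, p)\<in>splits e. f p (incr j q))"
    by (rule sum_splits_incr_left) (rule assms)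
  finally show ?thesis by (subst (2) sum_splits_swap)
qed

lemma finite_splits_snd:
  assumes "finite (splits e)" "(p, q) \<in> splits e"
  shows "finite (splits q)"
proof -
  have "inj_on (\<lambda>(u, v). (\<lambda>i. p i + u i, v)) (splits q)"
    by (auto simp: inj_on_def fun_eq_iff)
  moreover have "(\<lambda>(u, v). (\<lambda>i. p i + u i, v)) ` splits q \<subseteq> splits e"
    using assms(2) by (auto simp: splits_def add.assoc)
  ultimately show ?thesis using assms(1) by (metis finite_imageD finite_subset)
qed

lemma finite_splits_fst: "finite (splits e) \<Longrightarrow> (p, q) \<in> splits e \<Longrightarrow> finite (splits p)"
  using finite_splits_snd[of e q p] by (simp add: splits_def add.commute)

text \<open>Both double sums run over factorisations of e into three monomials; if the outer index
  set is infinite, both are 0.\<close>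

lemma sum_splits_assoc:
  fixes f :: "(nat \<Rightarrow> nat) \<Rightarrow> (nat \<Rightarrow> nat) \<Rightarrow> (nat \<Rightarrow> nat) \<Rightarrow> 'a::ab_group_add"
  shows "(\<Sum>(p, s)\<in>splits e. \<Sum>(q, r)\<in>splits s. f p q r) = (\<Sum>(s, r)\<in>splits e. \<Sum>(p, q)\<in>splits s. f p q r)"
proof (cases "finite (splits e)")
  case True
  have "(\<Sum>(p, s)\<in>splits e. \<Sum>(q, r)\<in>splits s. f p q r)
    = (\<Sum>(x, y)\<in>Sigma (splits e) (\<lambda>x. splits (snd x)). f (fst x) (fst y) (snd y))"
    using True by (subst sum.Sigma[symmetric]) (auto simp: case_prod_unfold intro: finite_splits_snd)
  also have "\<dots> = (\<Sum>(x, y)\<in>Sigma (splits e) (\<lambda>x. splits (fst x)). f (fst y) (snd y) (snd x))"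
    by (rule sum.reindex_bij_witness[where
        i = "\<lambda>(x, y). ((fst y, \<lambda>i. snd y i + snd x i), (snd y, snd x))" and
        j = "\<lambda>(x, y). ((\<lambda>i. fst x i + fst y i, snd y), (fst x, fst y))"])
      (auto simp: splits_iff add.assoc)
  also have "\<dots> = (\<Sum>(s, r)\<in>splits e. \<Sum>(p, q)\<in>splits s. f p q r)"
    using True by (subst sum.Sigma[symmetric]) (auto simp: case_prod_unfold intro: finite_splits_fst)
  finally show ?thesis .
qed simp

lemma sum_splits_0: "(\<Sum>(p, q)\<in>splits (\<lambda>_. 0). f p q) = f (\<lambda>_. 0) (\<lambda>_. 0)"
proof -
  have "splits (\<lambda>_. 0) = {(\<lambda>_. 0, \<lambda>_. 0)}" by (auto simp: splits_def)
  then show ?thesis by simp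
qed

context lie_algebra
begin

definition ser_scale :: "'k \<Rightarrow> ((nat \<Rightarrow> nat) \<Rightarrow> 'v) \<Rightarrow> (nat \<Rightarrow> nat) \<Rightarrow> 'v" where
  "ser_scale c S = (\<lambda>e. c \<odot> S e)"

definition ser_br :: "((nat \<Rightarrow> nat) \<Rightarrow> 'v) \<Rightarrow> ((nat \<Rightarrow> nat) \<Rightarrow> 'v) \<Rightarrow> (nat \<Rightarrow> nat) \<Rightarrow> 'v" where
  "ser_br S S' = (\<lambda>e. \<Sum>(p, q)\<in>splits e. br (S p) (S' q))"

definition ser_d :: "nat \<Rightarrow> ((nat \<Rightarrow> nat) \<Rightarrow> 'v) \<Rightarrow> (nat \<Rightarrow> nat) \<Rightarrow> 'v" where
  "ser_d j S = (\<lambda>e. of_nat (Suc (e j)) \<odot> S (incr j e))"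

text \<open>Variables 0 and 1 are \<open>x\<close> and \<open>t\<close>, so \<open>\<partial>/\<partial>u\<^sub>k\<close> acts on variable \<open>k + 2\<close>.\<close>
definition ser_du :: "nat \<Rightarrow> ((nat \<Rightarrow> nat) \<Rightarrow> 'v) \<Rightarrow> (nat \<Rightarrow> nat) \<Rightarrow> 'v" where
  "ser_du k = ser_d (k + 2)"

definition ser_var :: "nat \<Rightarrow> ((nat \<Rightarrow> nat) \<Rightarrow> 'v) \<Rightarrow> (nat \<Rightarrow> nat) \<Rightarrow> 'v" where
  "ser_var j S = (\<lambda>e. if 1 \<le> e j then S (decr j e) else 0)"

definition ser_m :: "(nat \<Rightarrow> 'k) \<Rightarrow> nat \<Rightarrow> ((nat \<Rightarrow> nat) \<Rightarrow> 'v) \<Rightarrow> (nat \<Rightarrow> nat) \<Rightarrow> 'v" where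
  "ser_m a k S = (\<lambda>e. a k \<odot> S e + ser_var (k + 2) S e)"

lemma br_sum_left: "br (\<Sum>i\<in>I. f i) y = (\<Sum>i\<in>I. br (f i) y)"
  by (induction I rule: infinite_finite_induct) (simp_all add: br_add_left)

lemma br_sum_right: "br y (\<Sum>i\<in>I. f i) = (\<Sum>i\<in>I. br y (f i))"
  by (induction I rule: infinite_finite_induct) (simp_all add: br_add_right)

lemma ser_br_self: "ser_br S S e = 0"
proof -
  let ?s = "ser_br S S e"
  have "?s = (\<Sum>(p, q)\<in>splits e. br (S q) (S p))"
    unfolding ser_br_def by (rule sum_splits_swap)
  also have "\<dots> = (\<Sum>(p, q)\<in>splits e. - br (S p) (S q))"
    by (intro sum.cong) (auto intro: br_skew)
  also have "\<dots> = - ?s" by (simp add: ser_br_def sum_negf case_prod_unfold)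
  finally have "?s + ?s = 0" by (simp add: eq_neg_iff_add_eq_0)
  then have "2 \<odot> ?s = 0" using scale_left_distrib[of 1 1 ?s] by simp
  then show ?thesis by simp
qed

lemma ser_jacobi: "ser_br R (ser_br S T) e = ser_br (ser_br R S) T e + ser_br S (ser_br R T) e"
proof -
  have "ser_br R (ser_br S T) e = (\<Sum>(p, s)\<in>splits e. \<Sum>(q, r)\<in>splits s. br (R p) (br (S q) (T r)))"
    by (simp add: ser_br_def br_sum_right case_prod_unfold)
  also have "\<dots> = (\<Sum>(s, r)\<in>splits e. \<Sum>(p, q)\<in>splits s. br (R p) (br (S q) (T r)))"
    by (rule sum_splits_assoc)
  also have "\<dots> = (\<Sum>(s, r)\<in>splits e. \<Sum>(p, q)\<in>splits s. br (br (R p) (S q)) (T r))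
    + (\<Sum>(s, r)\<in>splits e. \<Sum>(p, q)\<in>splits s. br (S q) (br (R p) (T r)))"
    by (subst jacobi) (simp add: sum.distrib case_prod_unfold)
  also have "(\<Sum>(s, r)\<in>splits e. \<Sum>(p, q)\<in>splits s. br (br (R p) (S q)) (T r)) = ser_br (ser_br R S) T e"
    by (simp add: ser_br_def br_sum_left case_prod_unfold)
  also have "(\<Sum>(s, r)\<in>splits e. \<Sum>(p, q)\<in>splits s. br (S q) (br (R p) (T r)))
    = (\<Sum>(s, r)\<in>splits e. \<Sum>(q, p)\<in>splits s. br (S q) (br (R p) (T r)))"
    by (intro sum.cong) (auto intro: sum_splits_swap)
  also have "\<dots> = (\<Sum>(q, s)\<in>splits e. \<Sum>(p, r)\<in>splits s. br (S q) (br (R p) (T r)))"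
    by (rule sum_splits_assoc[symmetric])
  also have "\<dots> = ser_br S (ser_br R T) e"
    by (simp add: ser_br_def br_sum_right case_prod_unfold)
  finally show ?thesis .
qed

text \<open>The factor e_j + 1 of the derivative is distributed as p_j + q_j over the two factors of
  each split.\<close>

lemma ser_d_br: "ser_d j (ser_br S T) e = ser_br (ser_d j S) T e + ser_br S (ser_d j T) e"
proof -
  have "ser_d j (ser_br S T) e
    = (\<Sum>(p, q)\<in>splits (incr j e). of_nat (Suc (e j)) \<odot> br (S p) (T q))"
    by (simp add: ser_d_def ser_br_def scale_sum_right case_prod_unfold)
  also have "\<dots> = (\<Sum>(p, q)\<in>splits (incr j e). of_nat (p j) \<odot> br (S p) (T q) + of_nat (q j) \<odot> br (S p) (T q))"
  proof (intro sum.cong refl, clarify)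
    fix p q assume "(p, q) \<in> splits (incr j e)"
    then have "p j + q j = Suc (e j)" by (simp add: splits_def)
    then show "of_nat (Suc (e j)) \<odot> br (S p) (T q)
      = of_nat (p j) \<odot> br (S p) (T q) + of_nat (q j) \<odot> br (S p) (T q)"
      by (metis of_nat_add scale_left_distrib)
  qed
  also have "\<dots> = (\<Sum>(p, q)\<in>splits (incr j e). of_nat (p j) \<odot> br (S p) (T q))
     + (\<Sum>(p, q)\<in>splits (incr j e). of_nat (q j) \<odot> br (S p) (T q))"
    by (simp add: sum.distrib case_prod_unfold)
  also have "(\<Sum>(p, q)\<in>splits (incr j e). of_nat (p j) \<odot> br (S p) (T q)) = ser_br (ser_d j S) T e"
    by (subst sum_splits_incr_left) (simp_all add: ser_br_def ser_d_def br_scale_left)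
  also have "(\<Sum>(p, q)\<in>splits (incr j e). of_nat (q j) \<odot> br (S p) (T q)) = ser_br S (ser_d j T) e"
    by (subst sum_splits_incr_right) (simp_all add: ser_br_def ser_d_def br_scale_right)
  finally show ?thesis .
qed

lemma ser_br_var: "ser_br (ser_var j S) T = ser_var j (ser_br S T)"
proof
  fix e
  show "ser_br (ser_var j S) T e = ser_var j (ser_br S T) e"
  proof (cases "1 \<le> e j")
    case True
    have "ser_br (ser_var j S) T (incr j (decr j e)) = ser_br S T (decr j e)"
      unfolding ser_br_def
      by (subst sum_splits_incr_left) (simp_all add: ser_var_def)
    moreover have "incr j (decr j e) = e" using True by auto
    ultimately show ?thesis using True by (simp add: ser_var_def)
  next
    case False
    have "br (ser_var j S p) (T q) = 0" if "(p, q) \<in> splits e" for p q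
    proof -
      have "p j + q j = e j" using that by (simp add: splits_def)
      then show ?thesis using False by (simp add: ser_var_def)
    qed
    then have "ser_br (ser_var j S) T e = 0" unfolding ser_br_def by (intro sum.neutral) auto
    then show ?thesis using False by (simp add: ser_var_def)
  qed
qed

lemma ser_br_add: "ser_br (S + S') T = ser_br S T + ser_br S' T"
  and ser_br_add': "ser_br T (S + S') = ser_br T S + ser_br T S'"
  and ser_br_scale: "ser_br (ser_scale c S) T = ser_scale c (ser_br S T)"
  and ser_br_scale': "ser_br T (ser_scale c S) = ser_scale c (ser_br T S)"
  by (simp_all add: fun_eq_iff ser_br_def ser_scale_def br_linear sum.distrib scale_sum_right case_prod_unfold)

lemma ser_var_d: "ser_d j (ser_var k S) = ser_var k (ser_d j S) + (if j = k then S else 0)"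
proof
  fix e
  show "ser_d j (ser_var k S) e = (ser_var k (ser_d j S) + (if j = k then S else 0)) e"
  proof (cases "j = k")
    case True
    show ?thesis
    proof (cases "e k")
      case (Suc n)
      have "incr k (decr k e) = e" using Suc by auto
      then show ?thesis using True Suc
        by (simp add: ser_d_def ser_var_def scale_left_distrib add.commute)
    qed (simp add: True ser_d_def ser_var_def)
  next
    case False
    then show ?thesis by (simp add: ser_d_def ser_var_def fun_upd_twist)
  qed
qed

lemma ser_d_add: "ser_d j (S + T) = ser_d j S + ser_d j T"
  and ser_d_scale: "ser_d j (ser_scale c S) = ser_scale c (ser_d j S)"
  and ser_m_add: "ser_m a k (S + T) = ser_m a k S + ser_m a k T"
  and ser_m_scale: "ser_m a k (ser_scale c S) = ser_scale c (ser_m a k S)"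
  by (auto simp: fun_eq_iff ser_d_def ser_scale_def ser_m_def ser_var_def scale_right_distrib mult.commute)

lemma ser_zero [simp]: "ser_d j 0 = 0" "ser_m a k 0 = 0" "ser_scale r 0 = 0"
  by (simp_all add: fun_eq_iff ser_d_def ser_m_def ser_var_def ser_scale_def)

lemma ser_m_alt: "ser_m a k S = ser_scale (a k) S + ser_var (k + 2) S"
  by (simp add: fun_eq_iff ser_m_def ser_scale_def)

lemma ser_d_m: "ser_d j (ser_m a k S) = ser_m a k (ser_d j S) + (if j = k + 2 then S else 0)"
  by (simp add: ser_m_alt ser_d_add ser_d_scale ser_var_d)

lemma ser_br_m: "ser_br (ser_m a k S) T = ser_m a k (ser_br S T)"
  by (simp add: ser_m_alt ser_br_add ser_br_scale ser_br_var)

lemma ser_d_d: "ser_d j (ser_d k S) = ser_d k (ser_d j S)"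
  by (cases "j = k") (simp_all add: fun_eq_iff ser_d_def fun_upd_twist mult.commute)

lemma ser_var_var: "ser_var j (ser_var k S) = ser_var k (ser_var j S)"
  by (cases "j = k") (auto simp add: fun_eq_iff ser_var_def fun_upd_twist)

lemma ser_m_m: "ser_m a j (ser_m a k S) = ser_m a k (ser_m a j S)"
proof -
  have add: "ser_var i (S + T) = ser_var i S + ser_var i T"
    and scale: "ser_var i (ser_scale c S) = ser_scale c (ser_var i S)" for i c S T
    by (auto simp: fun_eq_iff ser_var_def ser_scale_def)
  have "ser_scale c (S + T) = ser_scale c S + ser_scale c T"
    "ser_scale c (ser_scale b S) = ser_scale (c * b) S" for c b S T
    by (simp_all add: fun_eq_iff ser_scale_def scale_right_distrib)
  then show ?thesis
    using ser_var_var[of "j + 2" "k + 2" S]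
    by (simp add: ser_m_alt add scale mult.commute algebra_simps)
qed

lemma lie_algebra_ser: "lie_algebra ser_scale ser_br"
proof (unfold_locales, goal_cases)
  case (10 R S T)
  show ?case by (rule ext, rule trans[OF ser_jacobi]) simp
qed (rule ser_br_add ser_br_add' ser_br_scale ser_br_scale' |
    simp add: fun_eq_iff ser_br_self ser_scale_def scale_right_distrib scale_left_distrib)+

lemma zcr_calculus_ser:
  "zcr_calculus ser_scale ser_br (ser_d 0) (ser_d (Suc 0)) ser_du (ser_m a)"
proof -
  interpret ser: lie_algebra ser_scale ser_br by (rule lie_algebra_ser)
  show ?thesis
    by (unfold_locales, unfold ser_du_def)
      (rule ser_d_add ser_d_scale ser_m_add ser_m_scale ser_br_m ser_d_d ser_m_m |
       rule ext, rule trans[OF ser_d_br], simp | simp add: ser_d_m)+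
qed

end

section \<open>The free Lie algebra and its quotients\<close>

interpretation nc: vector_space "smul :: 'k::field \<Rightarrow> 'k nc \<Rightarrow> 'k nc"
  by unfold_locales (simp_all add: smul_def fun_eq_iff algebra_simps)

text \<open>The noncommutative counterpart of \<open>splits\<close>; with products as sums over
  cuts, associativity is a reindexing of cuts into three words.\<close>

definition cuts :: "'a list \<Rightarrow> ('a list \<times> 'a list) set" where
  "cuts w = {(u, v). u @ v = w}"

lemma cuts_eq: "cuts w = (\<lambda>i. (take i w, drop i w)) ` {..length w}"
proof
  show "cuts w \<subseteq> (\<lambda>i. (take i w, drop i w)) ` {..length w}"
  proof clarify
    fix u v assume "(u, v) \<in> cuts w"
    then have "(u, v) = (take (length u) w, drop (length u) w)" "length u \<le> length w"
      by (auto simp: cuts_def)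
    then show "(u, v) \<in> (\<lambda>i. (take i w, drop i w)) ` {..length w}" by blast
  qed
qed (auto simp: cuts_def)

lemma finite_cuts [simp]: "finite (cuts w)"
  by (simp add: cuts_eq)

lemma ncmul_eq: "ncmul p q w = (\<Sum>(u, v)\<in>cuts w. p u * q v)"
proof -
  have "inj_on (\<lambda>i. (take i w, drop i w)) {..length w}"
  proof (rule inj_onI)
    fix i j assume "i \<in> {..length w}" "j \<in> {..length w}"
      "(take i w, drop i w) = (take j w, drop j w)"
    then have "length (take i w) = length (take j w)" "i \<le> length w" "j \<le> length w" by auto
    then show "i = j" by simp
  qed
  then show ?thesis unfolding cuts_eq by (subst sum.reindex) (simp_all add: ncmul_def)
qed

lemma ncmul_assoc: "ncmul (ncmul p q) r = ncmul p (ncmul q r)"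
proof
  fix w
  have "ncmul (ncmul p q) r w = (\<Sum>x\<in>cuts w. \<Sum>y\<in>cuts (fst x). p (fst y) * q (snd y) * r (snd x))"
    by (simp add: ncmul_eq sum_distrib_right case_prod_unfold)
  also have "\<dots> = (\<Sum>(x, y)\<in>Sigma (cuts w) (\<lambda>x. cuts (fst x)). p (fst y) * q (snd y) * r (snd x))"
    by (subst sum.Sigma) auto
  also have "\<dots> = (\<Sum>(x, y)\<in>Sigma (cuts w) (\<lambda>x. cuts (snd x)). p (fst x) * q (fst y) * r (snd y))"
    by (rule sum.reindex_bij_witness[where
          j = "\<lambda>(x, y). ((fst y, snd y @ snd x), (snd y, snd x))" and
          i = "\<lambda>(x, y). ((fst x @ fst y, snd y), (fst x, fst y))"])
      (auto simp: cuts_def)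
  also have "\<dots> = (\<Sum>x\<in>cuts w. \<Sum>y\<in>cuts (snd x). p (fst x) * q (fst y) * r (snd y))"
    by (subst sum.Sigma) auto
  also have "\<dots> = ncmul p (ncmul q r) w"
    by (simp add: ncmul_eq sum_distrib_left case_prod_unfold mult.assoc)
  finally show "ncmul (ncmul p q) r w = ncmul p (ncmul q r) w" .
qed

lemma ncmul_linear:
  "ncmul (x + y) z = ncmul x z + ncmul y z" "ncmul z (x + y) = ncmul z x + ncmul z y"
  "ncmul (x - y) z = ncmul x z - ncmul y z" "ncmul z (x - y) = ncmul z x - ncmul z y"
  "ncmul (smul c x) z = smul c (ncmul x z)" "ncmul z (smul c x) = smul c (ncmul z x)"
  by (simp_all add: fun_eq_iff ncmul_def smul_def algebra_simps sum.distrib sum_subtractf sum_distrib_left)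

lemma ncbr_linear:
  "ncbr (x + y) z = ncbr x z + ncbr y z" "ncbr z (x + y) = ncbr z x + ncbr z y"
  "ncbr (x - y) z = ncbr x z - ncbr y z" "ncbr z (x - y) = ncbr z x - ncbr z y"
  "ncbr (smul c x) z = smul c (ncbr x z)" "ncbr z (smul c x) = smul c (ncbr z x)"
  by (simp_all add: ncbr_def ncmul_linear) (simp_all add: smul_def fun_eq_iff algebra_simps)

lemma ncbr_skew: "ncbr y x = - ncbr x y"
  by (simp add: ncbr_def)

lemma ncbr_jacobi: "ncbr x (ncbr y z) = ncbr (ncbr x y) z + ncbr y (ncbr x z)"
  by (simp add: ncbr_def ncmul_linear ncmul_assoc)

lemma free_lie_diff: "x \<in> free_lie \<Longrightarrow> y \<in> free_lie \<Longrightarrow> x - y \<in> (free_lie :: 'k::comm_ring_1 nc set)"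
  using fl_add[of x "smul (-1) y"] fl_smul[of y "-1"] by (simp add: smul_def fun_diff_def plus_fun_def)

lemma free_lie_sum: "(\<And>i. i \<in> I \<Longrightarrow> f i \<in> free_lie) \<Longrightarrow> (\<Sum>i\<in>I. f i) \<in> (free_lie :: 'k::comm_ring_1 nc set)"
  by (induction I rule: infinite_finite_induct) (auto intro: fl_zero fl_add)

lemma subspace_free_lie: "nc.subspace (free_lie :: 'k::field nc set)"
  by (auto simp: nc.subspace_def intro: fl_zero fl_add fl_smul)

lemma subspace_lie_ideal_gen: "nc.subspace (lie_ideal_gen R :: 'k::field nc set)"
  by (auto simp: nc.subspace_def intro: li_zero li_add li_smul)

lemma lie_ideal_gen_subset:
  assumes "R \<subseteq> free_lie"
  shows "lie_ideal_gen R \<subseteq> free_lie"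
proof
  fix x assume "x \<in> lie_ideal_gen R"
  then show "x \<in> free_lie"
    using assms by induction (auto intro: fl_zero fl_add fl_smul fl_br)
qed

lemma dvar_free_lie: "(\<And>e. S e \<in> free_lie) \<Longrightarrow> dvar j S e \<in> free_lie"
  and mulU_free_lie: "(\<And>e. S e \<in> free_lie) \<Longrightarrow> mulU a k S e \<in> free_lie"
  and mulF_free_lie: "(\<And>e. S e \<in> free_lie) \<Longrightarrow> mulF \<alpha> \<beta> a S e \<in> free_lie"
  and sbr_free_lie: "(\<And>e. S e \<in> free_lie) \<Longrightarrow> (\<And>e. S' e \<in> free_lie) \<Longrightarrow> sbr S S' e \<in> free_lie"
proof -
  show "dvar j S e \<in> free_lie" if "\<And>e. S e \<in> free_lie" for S :: "'a ser" and e
    using that by (simp add: dvar_def fl_smul)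
  show U: "mulU a k S e \<in> free_lie" if "\<And>e. S e \<in> free_lie" for S :: "'a ser" and a k e
    using that by (simp add: mulU_def mulvar_def sscale_def fl_smul fl_add fl_zero)
  show "mulF \<alpha> \<beta> a S e \<in> free_lie" if "\<And>e. S e \<in> free_lie" for S :: "'a ser" and e
    using that by (simp add: mulF_def sscale_def U fl_smul fl_add free_lie_diff)
  show "sbr S S' e \<in> free_lie" if "\<And>e. S e \<in> free_lie" "\<And>e. S' e \<in> free_lie" for S S' :: "'a ser" and e
    using that by (auto simp: sbr_def intro!: free_lie_sum fl_br)
qed

lemma Aser_free_lie: "Aser e \<in> free_lie" and Bser_free_lie: "Bser e \<in> free_lie"
  by (simp_all add: Aser_def Bser_def fl_letter fl_zero)

lemma relators_free_lie: "relators \<alpha> \<beta> a \<subseteq> free_lie"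
proof -
  have "DxB a e - DtA \<alpha> \<beta> a e + sbr Aser Bser e \<in> free_lie" for e
    unfolding DxB_def DtA_def
    by (intro fl_add free_lie_diff free_lie_sum dvar_free_lie mulU_free_lie mulF_free_lie
        sbr_free_lie Aser_free_lie Bser_free_lie)
  then show ?thesis by (auto simp: relators_def intro: fl_letter)
qed

lemma F0_ideal_free_lie: "F0_ideal \<alpha> \<beta> a \<subseteq> free_lie"
  unfolding F0_ideal_def by (rule lie_ideal_gen_subset[OF relators_free_lie])

section \<open>Homomorphisms out of the free Lie algebra and images of the relators\<close>

locale free_lie_hom = lie_algebra scale br
  for scale :: "'k::field_char_0 \<Rightarrow> 'v::ab_group_add \<Rightarrow> 'v" (infixr "\<odot>" 75)
    and br :: "'v \<Rightarrow> 'v \<Rightarrow> 'v" +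
  fixes \<tau> :: "'k nc \<Rightarrow> 'v"
  assumes hom_add: "x \<in> free_lie \<Longrightarrow> y \<in> free_lie \<Longrightarrow> \<tau> (x + y) = \<tau> x + \<tau> y"
    and hom_smul: "x \<in> free_lie \<Longrightarrow> \<tau> (smul r x) = r \<odot> \<tau> x"
    and hom_br: "x \<in> free_lie \<Longrightarrow> y \<in> free_lie \<Longrightarrow> \<tau> (ncbr x y) = br (\<tau> x) (\<tau> y)"
begin

lemma hom_zero: "\<tau> 0 = 0"
  using hom_smul[OF fl_zero, of 0] by (simp add: nc.scale_zero_left)

lemma hom_diff: "x \<in> free_lie \<Longrightarrow> y \<in> free_lie \<Longrightarrow> \<tau> (x - y) = \<tau> x - \<tau> y"
  using hom_add[of "x - y" y] by (simp add: free_lie_diff)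

lemma hom_sum: "(\<And>i. i \<in> I \<Longrightarrow> f i \<in> free_lie) \<Longrightarrow> \<tau> (\<Sum>i\<in>I. f i) = (\<Sum>i\<in>I. \<tau> (f i))"
  by (induction I rule: infinite_finite_induct) (auto simp: hom_zero hom_add free_lie_sum)

definition ser_hom :: "'k ser \<Rightarrow> (nat \<Rightarrow> nat) \<Rightarrow> 'v" where
  "ser_hom S = (\<lambda>e. \<tau> (S e))"

lemma hom_dvar: "(\<And>e. S e \<in> free_lie) \<Longrightarrow> ser_hom (dvar j S) = ser_d j (ser_hom S)"
  by (simp add: fun_eq_iff ser_hom_def dvar_def ser_d_def hom_smul)

lemma hom_mulU: "(\<And>e. S e \<in> free_lie) \<Longrightarrow> ser_hom (mulU a k S) = ser_m a k (ser_hom S)"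
  by (simp add: fun_eq_iff ser_hom_def mulU_def mulvar_def sscale_def ser_m_def ser_var_def
      hom_add hom_smul hom_zero fl_smul fl_zero)

lemma hom_sbr:
  assumes "\<And>e. S e \<in> free_lie" "\<And>e. S' e \<in> free_lie"
  shows "ser_hom (sbr S S') = ser_br (ser_hom S) (ser_hom S')"
proof
  fix e
  have "ser_hom (sbr S S') e = (\<Sum>p\<in>{p. \<forall>i. p i \<le> e i}. br (\<tau> (S p)) (\<tau> (S' (\<lambda>i. e i - p i))))"
    using assms by (simp add: ser_hom_def sbr_def hom_sum hom_br fl_br)
  also have "\<dots> = (\<Sum>(p, q)\<in>splits e. br (\<tau> (S p)) (\<tau> (S' q)))"
    by (rule sum.reindex_bij_witness[where i = fst and j = "\<lambda>p. (p, \<lambda>i. e i - p i)"])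
      (auto simp: splits_iff)
  finally show "ser_hom (sbr S S') e = ser_br (ser_hom S) (ser_hom S') e"
    by (simp add: ser_br_def ser_hom_def)
qed

abbreviation "\<A> \<equiv> ser_hom Aser"
abbreviation "\<B> \<equiv> ser_hom Bser"

definition zcr_defect :: "'k \<Rightarrow> 'k \<Rightarrow> (nat \<Rightarrow> 'k) \<Rightarrow> (nat \<Rightarrow> nat) \<Rightarrow> 'v" where
  "zcr_defect \<alpha> \<beta> a = ser_d 0 \<B> + ser_m a 1 (ser_d 2 \<B>) + ser_m a 2 (ser_d 3 \<B>)
     + ser_m a 3 (ser_d 4 \<B>) + ser_m a 4 (ser_d 5 \<B>) + ser_m a 5 (ser_d 6 \<B>) + ser_br \<A> \<B>
     - (ser_d 1 \<A> + ser_m a 5 (ser_d 2 \<A>)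
        + ser_scale (4 * \<alpha> - 6 * \<beta>) (ser_m a 1 (ser_m a 2 (ser_d 2 \<A>)))
        + ser_scale (8 * \<alpha> - 2 * \<beta>) (ser_m a 0 (ser_m a 3 (ser_d 2 \<A>)))
        - ser_scale (20 * \<alpha> * \<beta>) (ser_m a 0 (ser_m a 0 (ser_m a 1 (ser_d 2 \<A>)))))"

text \<open>Bridge between the presentation and the calculus: all relators of type (i) die under
  \<tau> exactly when the image series satisfy the zero-curvature equation in the coefficients
  concerned.\<close>

lemma hom_relator:
  "\<tau> (DxB a e - DtA \<alpha> \<beta> a e + sbr Aser Bser e) = zcr_defect \<alpha> \<beta> a e"
proof -
  note fl = Aser_free_lie Bser_free_lie dvar_free_lie mulU_free_lie mulF_free_lie sbr_free_lie
    fl_add free_lie_diff fl_smul free_lie_sum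
  have four: "{..4::nat} = {0, 1, 2, 3, 4}" by auto
  have h: "\<tau> (S e) = ser_hom S e" for S by (simp add: ser_hom_def)
  have "\<tau> (DxB a e) = (ser_d 0 \<B> + ser_m a 1 (ser_d 2 \<B>) + ser_m a 2 (ser_d 3 \<B>)
     + ser_m a 3 (ser_d 4 \<B>) + ser_m a 4 (ser_d 5 \<B>) + ser_m a 5 (ser_d 6 \<B>)) e"
    unfolding DxB_def
    by (simp add: hom_add hom_sum fl h hom_mulU hom_dvar four numeral_2_eq_2[symmetric])
  moreover have "\<tau> (DtA \<alpha> \<beta> a e) = (ser_d 1 \<A> + ser_m a 5 (ser_d 2 \<A>)
        + ser_scale (4 * \<alpha> - 6 * \<beta>) (ser_m a 1 (ser_m a 2 (ser_d 2 \<A>)))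
        + ser_scale (8 * \<alpha> - 2 * \<beta>) (ser_m a 0 (ser_m a 3 (ser_d 2 \<A>)))
        - ser_scale (20 * \<alpha> * \<beta>) (ser_m a 0 (ser_m a 0 (ser_m a 1 (ser_d 2 \<A>))))) e"
    unfolding DtA_def mulF_def sscale_def ser_scale_def
    by (simp add: hom_add hom_diff hom_smul fl h hom_mulU hom_dvar)
  moreover have "\<tau> (sbr Aser Bser e) = ser_br \<A> \<B> e"
    by (simp add: h hom_sbr fl)
  ultimately show ?thesis
    by (simp add: zcr_defect_def hom_add hom_diff DxB_def DtA_def fl)
qed

end

text \<open>A projection along V: a basis of V is extended to a basis of the space, then V's part is
  sent to 0 and the rest is fixed.\<close>

lemma (in vector_space) exists_linear_with_kernel:
  assumes "subspace V"
  obtains f where "\<And>x y. f (x + y) = f x + f y" "\<And>c x. f (scale c x) = scale c (f x)"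
    "\<And>x. f x = 0 \<longleftrightarrow> x \<in> V" "\<And>x. x - f x \<in> V"
proof -
  interpret p: vector_space_pair scale scale ..
  obtain B where B: "B \<subseteq> V" "independent B" "V \<subseteq> span B"
    using maximal_independent_subset by blast
  then have spanB: "span B = V" using assms by (simp add: span_subspace)
  obtain C where C: "B \<subseteq> C" "independent C" "UNIV \<subseteq> span C"
    using extend_basis_superset[OF B(2)] independent_extend_basis[OF B(2)] span_extend_basis[OF B(2)]
    by (intro that[of "extend_basis B"]) auto
  obtain f where f: "Vector_Spaces.linear scale scale f" "\<And>x. x \<in> C \<Longrightarrow> f x = (if x \<in> B then 0 else x)"
    using p.linear_independent_extend[OF C(2), of "\<lambda>x. if x \<in> B then 0 else x"] by blast
  interpret f: Vector_Spaces.linear scale scale f by fact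
  have V0: "f x = 0" if "x \<in> V" for x
    using that unfolding spanB[symmetric]
    by (induction rule: span_induct_alt) (use f(2) C(1) in \<open>auto simp: f.add f.scale f.zero\<close>)
  have diff: "x - f x \<in> V" for x
  proof -
    have "x \<in> span C" using C(3) by auto
    then show ?thesis
    proof (induction rule: span_induct_alt)
      case base
      show ?case using assms by (simp add: f.zero subspace_0)
    next
      case (step c x y)
      have "x - f x \<in> V" using step(1) f(2) B(1) assms by (auto simp: subspace_0)
      then have "scale c (x - f x) + (y - f y) \<in> V"
        using step assms by (simp add: subspace_add subspace_scale)
      then show ?case by (simp add: f.add f.scale algebra_simps)
    qed
  qed
  show ?thesis
  proof
    show "f x = 0 \<longleftrightarrow> x \<in> V" for x using V0 diff[of x] by auto
  qed (simp_all add: f.add f.scale diff)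
qed

text \<open>The quotient of the free Lie algebra by an ideal, carried by all of \<open>'k nc\<close>: a linear
  projection along the ideal transports the commutator bracket, so that congruence modulo the
  ideal becomes equality.\<close>
lemma quotient_lie_algebra:
  fixes I :: "'k::field_char_0 nc set"
  assumes I: "nc.subspace I" "I \<subseteq> free_lie" "\<And>x y. x \<in> free_lie \<Longrightarrow> y \<in> I \<Longrightarrow> ncbr x y \<in> I"
  obtains br \<tau> where "free_lie_hom smul br \<tau>" "\<And>x. x \<in> free_lie \<Longrightarrow> \<tau> x = 0 \<longleftrightarrow> x \<in> I"
proof -
  obtain \<tau> :: "'k nc \<Rightarrow> 'k nc" where \<tau>: "\<And>x y. \<tau> (x + y) = \<tau> x + \<tau> y" "\<And>c x. \<tau> (smul c x) = smul c (\<tau> x)"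
    "\<And>x. \<tau> x = 0 \<longleftrightarrow> x \<in> I" "\<And>x. x - \<tau> x \<in> I"
    using nc.exists_linear_with_kernel[OF I(1)] by metis
  obtain \<sigma> :: "'k nc \<Rightarrow> 'k nc" where \<sigma>: "\<And>x y. \<sigma> (x + y) = \<sigma> x + \<sigma> y" "\<And>c x. \<sigma> (smul c x) = smul c (\<sigma> x)"
    "\<And>x. \<sigma> x = 0 \<longleftrightarrow> x \<in> free_lie" "\<And>x. x - \<sigma> x \<in> free_lie"
    using nc.exists_linear_with_kernel[OF subspace_free_lie] by metis
  \<comment> \<open>\<open>\<rho>\<close> projects the whole type onto \<open>free_lie\<close>. The
    locale wants a bracket on all of \<open>'k nc\<close>, whereas \<open>I\<close> is known to
    absorb brackets with elements of \<open>free_lie\<close> only.\<close>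
  define \<rho> where "\<rho> x = x - \<sigma> x" for x
  have \<rho>: "\<rho> (x + y) = \<rho> x + \<rho> y" "\<rho> (smul c x) = smul c (\<rho> x)" "\<rho> x \<in> free_lie"
    "x \<in> free_lie \<Longrightarrow> \<rho> x = x" for x y c
    using \<sigma>(3)[of x] by (simp_all add: \<rho>_def \<sigma>(1,2,4) nc.scale_right_diff_distrib)
  define br where "br x y = \<tau> (ncbr (\<rho> x) (\<rho> y))" for x y
  have \<tau>_fl: "\<tau> x \<in> free_lie" if "x \<in> free_lie" for x
    using free_lie_diff[OF that, of "x - \<tau> x"] \<tau>(4)[of x] I(2) by auto
  have \<tau>_diff: "\<tau> (x - y) = \<tau> x - \<tau> y" for x y
    using \<tau>(1)[of "x - y" y] by simp
  have \<tau>_eq: "\<tau> x = \<tau> y" if "x - y \<in> I" for x y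
    using that \<tau>(3)[of "x - y"] \<tau>_diff[of x y] by simp
  have minus: "- x \<in> I" if "x \<in> I" for x
    using nc.subspace_neg[OF I(1) that] .
  \<comment> \<open>The class of a bracket depends only on the classes of its arguments, because
    \<open>y - \<tau> y\<close> lies in \<open>I\<close>. This lets the Jacobi identity
    descend.\<close>
  have red: "\<tau> (ncbr x (\<tau> y)) = \<tau> (ncbr x y)" "\<tau> (ncbr (\<tau> y) x) = \<tau> (ncbr y x)"
    if "x \<in> free_lie" for x y
  proof -
    have "ncbr x (y - \<tau> y) \<in> I" using that \<tau>(4) I(3) by blast
    then have d: "ncbr x y - ncbr x (\<tau> y) \<in> I" by (simp add: ncbr_linear)
    then show "\<tau> (ncbr x (\<tau> y)) = \<tau> (ncbr x y)" using \<tau>_eq by metis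
    show "\<tau> (ncbr (\<tau> y) x) = \<tau> (ncbr y x)"
      using \<tau>_eq[of "ncbr (\<tau> y) x" "ncbr y x"] d by (simp add: ncbr_skew[of _ x])
  qed
  have lie: "lie_algebra smul br"
  proof (unfold_locales, goal_cases)
    case (3 x)
    have "\<tau> 0 = 0" using \<tau>(3) I(1) nc.subspace_0 by blast
    then show ?case by (simp add: br_def ncbr_def)
  next
    case (6 x y z)
    have "br x (br y z) = \<tau> (ncbr (\<rho> x) (ncbr (\<rho> y) (\<rho> z)))" for x y z
      by (simp add: br_def \<rho> \<tau>_fl fl_br red)
    moreover have "br (br x y) z = \<tau> (ncbr (ncbr (\<rho> x) (\<rho> y)) (\<rho> z))" for x y z
      by (simp add: br_def \<rho> \<tau>_fl fl_br red)
    ultimately show ?case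
      by (simp flip: \<tau>(1)) (subst ncbr_jacobi, rule refl)
  qed (simp_all add: br_def \<rho> \<tau> ncbr_linear)
  interpret lie_algebra smul br by (rule lie)
  have "free_lie_hom smul br \<tau>"
    by unfold_locales (simp_all add: \<tau>(1,2) br_def \<rho> \<tau>_fl red fl_br)
  then show ?thesis using \<tau>(3) that by blast
qed

context lie_algebra
begin

lemma br_in_span:
  assumes G: "\<And>x y. x \<in> G \<Longrightarrow> y \<in> G' \<Longrightarrow> br x y \<in> span W"
    and x: "x \<in> span G" and y: "y \<in> span G'"
  shows "br x y \<in> span W"
  using x
proof (induction rule: span_induct_alt)
  case base
  show ?case by (simp add: span_zero)
next
  case (step c u v)
  from y have "br u y \<in> span W"
  proof (induction rule: span_induct_alt)
    case base
    show ?case by (simp add: span_zero)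
  next
    case (step d w z)
    then show ?case using G[OF \<open>u \<in> G\<close>] by (simp add: br_linear span_add span_scale)
  qed
  then show ?case using step by (simp add: br_linear span_add span_scale)
qed

lemmas br_span_closed = br_in_span[where G = G and G' = G and W = G for G]

lemma ser_d_zeroD:
  assumes "ser_d j S = 0" "1 \<le> e j"
  shows "S e = 0"
proof -
  have "ser_d j S (decr j e) = 0" using assms(1) by simp
  moreover have "incr j (decr j e) = e" using assms(2) by auto
  ultimately have "of_nat (e j) \<odot> S e = 0" using assms(2) by (simp add: ser_d_def)
  then show ?thesis using assms(2) by simp
qed

lemma ser_br_0: "ser_br S T (\<lambda>_. 0) = br (S (\<lambda>_. 0)) (T (\<lambda>_. 0))"
  by (simp add: ser_br_def sum_splits_0)

lemma ser_m_eval: "e (k + 2) = 0 \<Longrightarrow> ser_m a k S e = a k \<odot> S e"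
  by (simp add: ser_m_def ser_var_def)

end

section \<open>A spanning set of the quotient\<close>

definition expo :: "nat \<Rightarrow> nat \<Rightarrow> nat \<Rightarrow> nat \<Rightarrow> nat" where
  "expo l1 l2 i = (\<lambda>n. if n = 0 then l1 else if n = 1 then l2 else if n = 2 then i else 0)"

lemma expo_simps [simp]: "expo l1 l2 i 0 = l1" "expo l1 l2 i 1 = l2" "expo l1 l2 i (Suc 0) = l2"
  "expo l1 l2 i 2 = i" "3 \<le> n \<Longrightarrow> expo l1 l2 i n = 0"
  by (simp_all add: expo_def)

lemma expo_update [simp]: "(expo l1 l2 i)(0 := n) = expo n l2 i"
  "(expo l1 l2 i)(1 := n) = expo l1 n i" "(expo l1 l2 i)(Suc 0 := n) = expo l1 n i"
  "(expo l1 l2 i)(2 := n) = expo l1 l2 n"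
  by (auto simp: expo_def fun_eq_iff)

lemma expo_0: "expo 0 0 0 = (\<lambda>_. 0)"
  by (simp add: expo_def fun_eq_iff)

lemma expo_eqI: "(\<And>n. 2 \<le> n \<Longrightarrow> e n = 0) \<Longrightarrow> e = expo (e 0) (e 1) 0"
  by (auto simp: expo_def fun_eq_iff not_less_eq_eq numeral_2_eq_2)

lemma Aser_expo: "Aser (expo l1 l2 i) = letter (GA l1 l2 i)"
  by (simp add: Aser_def)

locale zcr_quotient = free_lie_hom scale br \<tau>
  for scale :: "'k::field_char_0 \<Rightarrow> 'v::ab_group_add \<Rightarrow> 'v" (infixr "\<odot>" 75)
    and br :: "'v \<Rightarrow> 'v \<Rightarrow> 'v" and \<tau> :: "'k nc \<Rightarrow> 'v" +
  fixes \<alpha> \<beta> :: 'k and a :: "nat \<Rightarrow> 'k"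
  assumes relators_zero: "r \<in> relators \<alpha> \<beta> a \<Longrightarrow> \<tau> r = 0"
    and nonexceptional: "6 * \<alpha> + \<beta> \<noteq> 0" "\<alpha> + \<beta> \<noteq> 0" "16 * \<alpha> + \<beta> \<noteq> 0"
begin

lemma d_ser_A: "3 \<le> j \<Longrightarrow> ser_d j \<A> = 0"
  by (auto simp: fun_eq_iff ser_d_def ser_hom_def Aser_def hom_zero)

lemma d_ser_B: "7 \<le> j \<Longrightarrow> ser_d j \<B> = 0"
  by (auto simp: fun_eq_iff ser_d_def ser_hom_def Bser_def hom_zero)

lemma zcr_defect_zero: "zcr_defect \<alpha> \<beta> a = 0"
proof
  fix e
  show "zcr_defect \<alpha> \<beta> a e = (0 :: (nat \<Rightarrow> nat) \<Rightarrow> 'v) e"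
  proof (cases "\<forall>i\<ge>8. e i = 0")
    case True
    then have "DxB a e - DtA \<alpha> \<beta> a e + sbr Aser Bser e \<in> relators \<alpha> \<beta> a"
      by (auto simp: relators_def)
    from relators_zero[OF this] show ?thesis unfolding hom_relator by simp
  next
    \<comment> \<open>Relators exist for exponents in the variables 0 to 7, that is up to u_5. No
      term of the equation depends on a later variable, so \<open>ser_d i\<close> kills the defect
      and the remaining coefficients vanish as well.\<close>
    case False
    then obtain i where "8 \<le> i" "e i \<noteq> 0" by blast
    then have i: "8 \<le> i" "1 \<le> e i" and i2: "i - 2 + 2 = i" by simp_all
    interpret zc: zcr_calculus ser_scale ser_br "ser_d 0" "ser_d (Suc 0)" ser_du "ser_m a"
      by (rule zcr_calculus_ser)
    have d: "ser_d i (ser_d j S) = 0" if "ser_d i S = 0" for j S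
      using that ser_d_d[of i j S] by simp
    have AB: "ser_d i \<A> = 0" "ser_d i \<B> = 0"
      using i(1) by (simp_all add: d_ser_A d_ser_B)
    have "ser_d i (ser_br \<A> \<B>) = 0"
      using zc.d_br_zero[of "i - 2" \<A> \<B>] AB unfolding ser_du_def i2 by blast
    moreover have "ser_d i (S - T) = ser_d i S - ser_d i T" for S T
      using zc.diff_ops(3)[of "i - 2" S T] unfolding ser_du_def i2 .
    ultimately have "ser_d i (zcr_defect \<alpha> \<beta> a) = 0"
      using i(1) by (simp add: zcr_defect_def ser_d_add ser_d_scale ser_d_m d AB)
    then show ?thesis using i(2) ser_d_zeroD by (metis zero_fun_apply)
  qed
qed

sublocale zc: zcr_nonexceptional ser_scale ser_br "ser_d 0" "ser_d (Suc 0)" ser_du "ser_m a"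
  \<alpha> \<beta> \<A> \<B>
proof -
  interpret zc: zcr_calculus ser_scale ser_br "ser_d 0" "ser_d (Suc 0)" ser_du "ser_m a"
    by (rule zcr_calculus_ser)
  show "zcr_nonexceptional ser_scale ser_br (ser_d 0) (ser_d (Suc 0)) ser_du (ser_m a) \<alpha> \<beta> \<A> \<B>"
  proof unfold_locales
    show "ser_d 0 \<B> + ser_m a 1 (ser_du 0 \<B>) + ser_m a 2 (ser_du 1 \<B>) +
      ser_m a 3 (ser_du 2 \<B>) + ser_m a 4 (ser_du 3 \<B>) +
      ser_m a 5 (ser_du 4 \<B>) + ser_br \<A> \<B> =
      ser_d (Suc 0) \<A> + ser_m a 5 (ser_du 0 \<A>) +
      ser_scale (4 * \<alpha> - 6 * \<beta>) (ser_m a 1 (ser_m a 2 (ser_du 0 \<A>))) +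
      ser_scale (8 * \<alpha> - 2 * \<beta>) (ser_m a 0 (ser_m a 3 (ser_du 0 \<A>))) -
      ser_scale (20 * \<alpha> * \<beta>) (ser_m a 0 (ser_m a 0 (ser_m a 1 (ser_du 0 \<A>))))"
      using zcr_defect_zero unfolding zcr_defect_def ser_du_def by (simp add: numeral_3_eq_3 eval_nat_numeral)
  qed (use nonexceptional in \<open>simp_all add: ser_du_def d_ser_A d_ser_B\<close>)
qed

lemma ser_d_const:
  assumes "2 \<le> j"
  shows "ser_d j (zc.X i) = 0" "ser_d j zc.Y = 0" "ser_d j zc.Z = 0" "ser_d j zc.H = 0"
proof -
  have "j - 2 + 2 = j" using assms by simp
  then show "ser_d j (zc.X i) = 0" "ser_d j zc.Y = 0" "ser_d j zc.Z = 0" "ser_d j zc.H = 0"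
    using zc.d_X[of "j - 2" i] zc.d_Y[of "j - 2"] zc.d_Z[of "j - 2"] zc.d_H[of "j - 2"]
    unfolding ser_du_def by simp_all
qed

text \<open>The relators \<open>GA l1 l2 0\<close> say that A vanishes at u_0 = a_0, where A equals
  a_0 X + Z. Consequently the x-derivative is \<delta> + a_0 ad X.\<close>

lemma Z_eq: "zc.Z = - ser_scale (a 0) (zc.X 0)"
proof -
  let ?W = "zc.Z + ser_scale (a 0) (zc.X 0)"
  have "?W e = 0" for e
  proof (cases "e 2 = 0")
    case True
    have "\<A> e = 0"
    proof (cases "\<forall>i\<ge>3. e i = 0")
      case True
      then have "\<A> e = \<tau> (letter (GA (e 0) (e 1) 0))"
        using \<open>e 2 = 0\<close> by (simp add: ser_hom_def Aser_def)
      also have "\<dots> = 0" by (rule relators_zero) (auto simp: relators_def)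
      finally show ?thesis .
    qed (auto simp: ser_hom_def Aser_def hom_zero)
    moreover have "\<A> e = ser_m a 0 (zc.X 0) e + zc.Z e" by (subst zc.A_eq) simp
    ultimately show ?thesis using True ser_m_eval[of e 0 a "zc.X 0"] by (simp add: ser_scale_def add.commute numeral_2_eq_2)
  next
    case False
    have "ser_d 2 ?W = 0" by (simp add: ser_d_add ser_d_scale ser_d_const)
    from ser_d_zeroD[OF this, of e] False show ?thesis by simp
  qed
  then have "?W = 0" by (simp add: fun_eq_iff)
  then show ?thesis by (simp add: eq_neg_iff_add_eq_0)
qed

lemma A_var: "\<A> = ser_var 2 (zc.X 0)"
proof -
  have "\<A> = ser_m a 0 (zc.X 0) + zc.Z" by (rule zc.A_eq)
  then show ?thesis by (simp add: Z_eq ser_m_alt numeral_2_eq_2)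
qed

lemma X0_val: "zc.X 0 (expo l1 l2 0) = \<tau> (letter (GA l1 l2 1))"
proof -
  have "\<tau> (letter (GA l1 l2 1)) = \<A> (expo l1 l2 1)" by (simp add: ser_hom_def Aser_expo)
  also have "\<dots> = ser_var 2 (zc.X 0) (expo l1 l2 1)" using A_var by (rule fun_cong)
  also have "(expo l1 l2 1)(2 := 0) = expo l1 l2 0" by (auto simp: expo_def)
  then have "ser_var 2 (zc.X 0) (expo l1 l2 1) = zc.X 0 (expo l1 l2 0)" by (simp add: ser_var_def)
  finally show ?thesis ..
qed

lemma br_Z: "ser_br zc.Z S = - ser_scale (a 0) (ser_br (zc.X 0) S)"
  by (simp add: Z_eq zc.br_linear)

lemma X_Suc: "ser_d 0 (zc.X k) = zc.X (Suc k) + ser_scale (a 0) (ser_br (zc.X 0) (zc.X k))"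
  using zc.\<delta>_X[of k] unfolding zc.\<delta>_def br_Z by (simp add: algebra_simps)

lemma dx_eqs:
  "ser_d 0 (zc.X 0) = zc.X 1" "ser_d 0 (zc.X 1) = zc.X 2 + ser_scale (a 0) zc.Y"
  "ser_d 0 (zc.X 2) = ser_scale (- 4 * \<alpha> * a 0) (zc.X 1)"
  "ser_d 0 zc.Y = ser_scale (- 4 * \<alpha>) (zc.X 1)" "ser_d 0 zc.H = 0"
proof -
  show "ser_d 0 (zc.X 0) = zc.X 1" "ser_d 0 (zc.X 1) = zc.X 2 + ser_scale (a 0) zc.Y"
    using X_Suc[of 0] X_Suc[of 1] by (simp_all add: zc.br_X0_X1 numeral_2_eq_2)
  show "ser_d 0 (zc.X 2) = ser_scale (- 4 * \<alpha> * a 0) (zc.X 1)"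
    using X_Suc[of 2] by (simp add: zc.brackets zc.X_zero mult.commute)
  show "ser_d 0 zc.Y = ser_scale (- 4 * \<alpha>) (zc.X 1)"
    using zc.\<delta>_Y' unfolding zc.\<delta>_def br_Z by (simp add: zc.brackets)
  \<comment> \<open>With Z = -a_0 X, the equation \<delta> H = dt Z has the term -a_0 [X, H] on both
    sides, so H does not depend on x.\<close>
  have "ser_d 1 (zc.X 0) = ser_br (zc.X 0) zc.H"
    using zc.D_zero(1)[of 0] zc.br_skew[of zc.H "zc.X 0"] by (simp add: zc.D_def eq_neg_iff_add_eq_0)
  then show "ser_d 0 zc.H = 0"
    using zc.zcr_H(1) unfolding zc.\<delta>_def br_Z by (simp add: Z_eq)
qed

definition "gens = {zc.X 0, zc.X 1, zc.X 2, zc.Y}"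

lemma gens_span: "zc.X 0 \<in> zc.span gens" "zc.X 1 \<in> zc.span gens" "zc.X (Suc 0) \<in> zc.span gens" "zc.X 2 \<in> zc.span gens" "zc.Y \<in> zc.span gens"
  by (simp_all add: gens_def zc.span_base)

lemma dx_span:
  assumes "S \<in> zc.span gens"
  shows "ser_d 0 S \<in> zc.span gens"
  using assms
proof (rule zc.span_induct_alt[where h = "\<lambda>S. ser_d 0 S \<in> zc.span gens"], goal_cases)
  case (2 r x y)
  from 2(1) have "ser_d 0 x \<in> zc.span gens"
    unfolding gens_def by (elim insertE emptyE) (simp_all only: dx_eqs,
      simp_all add: gens_span[unfolded gens_def] zc.span_scale zc.span_add zc.span_neg del: One_nat_def)
  then show ?case using 2(2) by (simp add: zc.span_add zc.span_scale)
qed (simp add: zc.span_zero)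

lemma dt_span:
  assumes "S \<in> zc.span gens"
  shows "ser_d 1 S = - ser_br zc.H S"
  using assms
proof (rule zc.span_induct_alt[where h = "\<lambda>S. ser_d 1 S = - ser_br zc.H S"], goal_cases)
  case (2 r x y)
  from 2(1) have "zc.D x = 0"
    unfolding gens_def by (auto simp: zc.D_zero)
  then have "ser_d 1 x = - ser_br zc.H x" by (simp add: zc.D_def eq_neg_iff_add_eq_0)
  then show ?case using 2(2) by (simp add: zc.br_linear zc.scale_minus_right)
qed simp

lemma du_span:
  assumes "S \<in> zc.span gens" "2 \<le> j"
  shows "ser_d j S = 0"
  using assms(1)
proof (rule zc.span_induct_alt[where h = "\<lambda>S. ser_d j S = 0"], goal_cases)
  case (2 r x y)
  from 2(1) have "ser_d j x = 0"
    unfolding gens_def using assms(2) by (auto simp: ser_d_const)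
  then show ?case using 2(2) by (simp add: ser_d_add ser_d_scale)
qed simp

lemma br_span: "S \<in> zc.span gens \<Longrightarrow> T \<in> zc.span gens \<Longrightarrow> ser_br S T \<in> zc.span gens"
proof (rule zc.br_span_closed)
  fix x y assume "x \<in> gens" "y \<in> gens"
  moreover note s = gens_span zc.span_scale zc.span_neg zc.span_zero
  moreover have "ser_br (zc.X 1) (zc.X 0) = - zc.Y"
    "ser_br (zc.X 2) (zc.X 0) = - ser_scale (- (4 * \<alpha>)) (zc.X 1)" "ser_br zc.Y (zc.X 0) = - 0"
    "ser_br (zc.X 2) (zc.X 1) = - ser_scale (- (4 * \<alpha>)) (zc.X 2)"
    "ser_br zc.Y (zc.X 1) = - ser_scale (4 * \<alpha>) zc.Y"
    "ser_br zc.Y (zc.X 2) = - ser_scale (- (16 * \<alpha>\<^sup>2)) (zc.X 1)"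
    by (simp_all only: zc.br_skew[of "zc.X 1" "zc.X 0"] zc.br_skew[of "zc.X 2" "zc.X 0"]
      zc.br_skew[of "zc.Y" "zc.X 0"] zc.br_skew[of "zc.X 2" "zc.X 1"] zc.br_skew[of "zc.Y" "zc.X 1"]
      zc.br_skew[of "zc.Y" "zc.X 2"] zc.brackets)
  ultimately show "ser_br x y \<in> zc.span gens"
    unfolding gens_def using zc.brackets
    by (elim insertE emptyE) (simp_all add: s[unfolded gens_def] del: One_nat_def)
qed

abbreviation origin :: "nat \<Rightarrow> nat" where "origin \<equiv> \<lambda>_. 0"

definition "vals = {zc.X 0 origin, zc.X 1 origin, zc.X 2 origin, zc.Y origin}"

text \<open>The right-hand side of \<open>zc.B_eq\<close> without H, evaluated at u_k = a_k.\<close>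

definition "G = ser_scale (a 4) (zc.X 0) - ser_scale (a 3) (zc.X 1)
  + ser_scale (a 2) (zc.X 2 + ser_scale (a 0) zc.Y)
  + ser_scale (8 * \<alpha> - 2 * \<beta>) (ser_scale (a 0) (ser_scale (a 2) (zc.X 0)))
  + ser_scale (2 * \<beta>) (ser_scale (a 0) (ser_scale (a 1) (zc.X 1)))
  - ser_scale (1/2) (ser_scale (a 1) (ser_scale (a 1) (zc.Y + ser_scale (4 * \<alpha> + 4 * \<beta>) (zc.X 0))))
  - ser_scale \<beta> (ser_scale (a 0) (ser_scale (a 0) (zc.X 2)))
  - ser_scale (1/3) (ser_scale (a 0) (ser_scale (a 0) (ser_scale (a 0)
      (ser_scale (2 * \<beta>) zc.Y + ser_scale (20 * \<alpha> * \<beta>) (zc.X 0)))))"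

lemma G_span: "G \<in> zc.span gens"
  unfolding G_def by (intro zc.span_add zc.span_diff zc.span_scale gens_span)

text \<open>The relators \<open>GB 0 l2 0 0 0 0 0\<close> say that B vanishes for x = x_a and u_k =
  a_k, which fixes H on that line.\<close>

lemma H_eq:
  assumes "\<And>i. 2 \<le> i \<Longrightarrow> e i = 0" "e 0 = 0"
  shows "zc.H e = - G e"
proof -
  have m: "ser_m a k S e = a k \<odot> S e" for k S
    using assms by (intro ser_m_eval) simp
  have "\<B> e = \<tau> (letter (GB 0 (e 1) 0 0 0 0 0))"
    using assms by (simp add: ser_hom_def Bser_def)
  also have "\<dots> = 0" by (rule relators_zero) (auto simp: relators_def)
  finally have "(G + zc.H) e = 0"
    using fun_cong[OF zc.B_eq, of e] by (simp add: G_def m ser_scale_def scale_right_distrib)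
  then show ?thesis by (simp add: eq_neg_iff_add_eq_0 add.commute)
qed

lemma span_origin:
  assumes "S \<in> zc.span gens"
  shows "S origin \<in> span vals"
  using assms
proof (rule zc.span_induct_alt[where h = "\<lambda>S. S origin \<in> span vals"], goal_cases)
  case (2 r x y)
  from 2(1) have "x origin \<in> span vals"
    unfolding gens_def by (elim insertE emptyE) (auto simp: vals_def intro: span_base)
  then show ?case using 2(2) by (simp add: ser_scale_def span_add span_scale)
qed (simp add: span_zero)

text \<open>Induction on the degree in x and t. An x-derivative stays in the span of
  \<open>gens\<close>; on x = x_a a t-derivative is -[H, S] = [G, S], again in that span. Every
  coefficient thus reduces to values at the origin.\<close>

lemma coeff_span:
  assumes "S \<in> zc.span gens" "\<And>i. 2 \<le> i \<Longrightarrow> e i = 0"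
  shows "S e \<in> span vals"
  using assms
proof (induction "e 0 + e 1" arbitrary: S e rule: less_induct)
  case less
  have scaled: "S e \<in> span vals" if "of_nat (e j) \<odot> S e \<in> span vals" "e j \<noteq> 0" for j
  proof -
    have "S e = (1 / of_nat (e j)) \<odot> of_nat (e j) \<odot> S e" using that(2) by simp
    then show ?thesis using that(1) span_scale by metis
  qed
  have incr_decr: "of_nat (e j) \<odot> S e = ser_d j S (decr j e)" if "e j \<noteq> 0" for j
  proof -
    have "incr j (decr j e) = e" using that by auto
    then show ?thesis using that by (simp add: ser_d_def)
  qed
  consider "e 0 \<noteq> 0" | "e 0 = 0" "e 1 \<noteq> 0" | "e 0 = 0" "e 1 = 0" by blast
  then show ?case
  proof cases
    case 1
    have "ser_d 0 S (decr 0 e) \<in> span vals"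
      using 1 less.prems by (intro less.hyps[OF _ dx_span[OF less.prems(1)]]) auto
    then show ?thesis using scaled[of 0] incr_decr[of 0] 1 by simp
  next
    case 2
    have "ser_d 1 S (decr 1 e) = - ser_br zc.H S (decr 1 e)"
      using dt_span[OF less.prems(1)] by simp
    \<comment> \<open>All factors of a monomial in t alone are monomials in t alone, and on these H
      may be replaced by -G.\<close>
    also have "\<dots> = ser_br G S (decr 1 e)"
    proof -
      have "br (zc.H p) (S q) = - br (G p) (S q)" if "(p, q) \<in> splits (decr 1 e)" for p q
      proof -
        have "p i + q i = (decr 1 e) i" for i using that by (simp add: splits_def)
        moreover have "(decr 1 e) i = 0" if "2 \<le> i \<or> i = 0" for i
          using that 2 less.prems(2)[of i] by auto
        ultimately have "p i = 0" if "2 \<le> i \<or> i = 0" for i using that by (metis add_is_0)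
        then have "zc.H p = - G p" by (intro H_eq) auto
        then show ?thesis by (simp add: br_minus)
      qed
      then have "ser_br zc.H S (decr 1 e) = (\<Sum>(p, q)\<in>splits (decr 1 e). - br (G p) (S q))"
        unfolding ser_br_def by (intro sum.cong) auto
      then show ?thesis by (simp add: ser_br_def sum_negf case_prod_unfold)
    qed
    also have "\<dots> \<in> span vals"
      using 2 less.prems by (intro less.hyps[OF _ br_span[OF G_span less.prems(1)]]) auto
    finally show ?thesis using scaled[of 1] incr_decr[of 1] 2 by simp
  next
    case 3
    have "e i = 0" for i
      using 3 less.prems(2)[of i] by (cases "i = 0"; cases "i = 1") auto
    then have "e = origin" by auto
    then show ?thesis using span_origin[OF less.prems(1)] by simp
  qed
qed

lemma coeff_span_all:
  assumes "S \<in> zc.span gens"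
  shows "S e \<in> span vals"
proof (cases "\<forall>i\<ge>2. e i = 0")
  case True
  then show ?thesis using coeff_span[OF assms] by blast
next
  case False
  then obtain i where "2 \<le> i" "e i \<noteq> 0" by blast
  then have "S e = 0" using ser_d_zeroD[OF du_span[OF assms], of i e] by simp
  then show ?thesis by (simp add: span_zero)
qed

text \<open>H depends on t only, and its t-coefficients are those of -G.\<close>

lemma H_span: "zc.H e \<in> span vals"
proof (cases "(\<forall>i\<ge>2. e i = 0) \<and> e 0 = 0")
  case True
  then have "zc.H e = - G e" by (intro H_eq) auto
  then show ?thesis using coeff_span_all[OF G_span] by (simp add: span_neg)
next
  case False
  then obtain i where "2 \<le> i \<or> i = 0" "e i \<noteq> 0" by blast
  then have "zc.H e = 0"
    using ser_d_zeroD[of i zc.H e] dx_eqs(5) ser_d_const(4)[of i] by auto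
  then show ?thesis by (simp add: span_zero)
qed

lemma m_span: "(\<And>e. S e \<in> span vals) \<Longrightarrow> ser_m a k S e \<in> span vals"
  by (simp add: ser_m_def ser_var_def span_add span_scale span_zero)

lemma A_span: "\<A> e \<in> span vals"
proof -
  have "\<A> e = ser_var 2 (zc.X 0) e" using A_var by (rule fun_cong)
  then show ?thesis using coeff_span_all[OF gens_span(1)] by (simp add: ser_var_def span_zero)
qed

lemma B_span: "\<B> e \<in> span vals"
proof -
  note s = gens_span[THEN coeff_span_all]
  have scale: "ser_scale r S e \<in> span vals" if "\<And>e. S e \<in> span vals" for r S e
    using that by (simp add: ser_scale_def span_scale)
  have add: "(S + T) e \<in> span vals" "(S - T) e \<in> span vals"
    if "\<And>e. S e \<in> span vals" "\<And>e. T e \<in> span vals" for S T e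
    using that by (simp_all add: span_add span_diff)
  show ?thesis
    unfolding fun_cong[OF zc.B_eq, of e]
    by (intro add scale m_span s H_span)
qed

lemma br_vals: "x \<in> span vals \<Longrightarrow> y \<in> span vals \<Longrightarrow> br x y \<in> span vals"
proof (rule br_span_closed)
  fix x y assume "x \<in> vals" "y \<in> vals"
  then obtain S T where "S \<in> gens" "T \<in> gens" "x = S origin" "y = T origin"
    by (auto simp: vals_def gens_def)
  then show "br x y \<in> span vals"
    using span_origin[OF br_span[of S T]] by (simp add: zc.span_base ser_br_0)
qed

lemma hom_span:
  assumes "x \<in> free_lie"
  shows "\<tau> x \<in> span vals"
  using assms
proof induction
  case (fl_letter g)
  show ?case
  proof (cases g)
    case (GA l1 l2 i)
    have "\<tau> (letter g) = \<A> (expo l1 l2 i)" by (simp add: GA ser_hom_def Aser_expo)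
    then show ?thesis using A_span by simp
  next
    case (GB l1 l2 j0 j1 j2 j3 j4)
    define e where "e n = (if n < 7 then [l1, l2, j0, j1, j2, j3, j4] ! n else 0)" for n
    have "\<tau> (letter g) = \<B> e" by (simp add: GB ser_hom_def Bser_def e_def)
    then show ?thesis using B_span by simp
  qed
next
  case fl_zero
  have "\<tau> 0 \<in> span vals" by (simp add: hom_zero span_zero)
  then show ?case by (simp only: zero_fun_def)
next
  case (fl_add x y)
  then have "\<tau> (x + y) \<in> span vals" by (simp add: hom_add span_add)
  then show ?case by (simp only: plus_fun_def)
qed (simp_all add: hom_smul hom_br span_scale br_vals)

text \<open>The generators \<open>GA l1 0 1\<close> are the x-Taylor coefficients of X at a. The
  last line combines the factor 2! of the second derivative with X_xx = X_2 + a_0 Y.\<close>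

lemma vals_eqs:
  "zc.X 0 origin = \<tau> (letter (GA 0 0 1))"
  "zc.X 1 origin = \<tau> (letter (GA 1 0 1))"
  "zc.Y origin = \<tau> (ncbr (letter (GA 0 0 1)) (letter (GA 1 0 1)))"
  "zc.X 2 origin = 2 \<odot> \<tau> (letter (GA 2 0 1)) - a 0 \<odot> zc.Y origin"
proof -
  show X0: "zc.X 0 origin = \<tau> (letter (GA 0 0 1))" by (simp only: X0_val flip: expo_0)
  have X1: "zc.X 1 e = ser_d 0 (zc.X 0) e" for e by (simp only: dx_eqs)
  show X1o: "zc.X 1 origin = \<tau> (letter (GA 1 0 1))"
    unfolding X1 by (simp add: ser_d_def X0_val expo_0[symmetric])
  show "zc.Y origin = \<tau> (ncbr (letter (GA 0 0 1)) (letter (GA 1 0 1)))"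
    unfolding hom_br[OF fl_letter fl_letter] X0[symmetric] X1o[symmetric] zc.brackets(1)[symmetric]
    by (rule ser_br_0)
  have "zc.X 2 + ser_scale (a 0) zc.Y = ser_d 0 (ser_d 0 (zc.X 0))" by (simp only: dx_eqs)
  from fun_cong[OF this, of origin]
  show "zc.X 2 origin = 2 \<odot> \<tau> (letter (GA 2 0 1)) - a 0 \<odot> zc.Y origin"
    by (simp add: ser_scale_def ser_d_def X0_val expo_0[symmetric] eq_diff_eq numeral_2_eq_2)
qed

end

lemma (in free_lie_hom) span_lift:
  assumes S: "S \<subseteq> free_lie" and y: "y \<in> span (\<tau> ` S)"
  shows "\<exists>u\<in>nc.span S. \<tau> u = y"
  using y
proof (induction rule: span_induct_alt)
  case base
  have "\<tau> 0 = 0" "0 \<in> nc.span S" by (rule hom_zero, rule nc.span_zero)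
  then show ?case by blast
next
  case (step r x y)
  then obtain s u where s: "s \<in> S" "x = \<tau> s" and u: "u \<in> nc.span S" "\<tau> u = y" by blast
  have "nc.span S \<subseteq> free_lie" by (rule nc.span_minimal[OF S subspace_free_lie])
  then have "u \<in> free_lie" "s \<in> free_lie" using u S s by auto
  then have "\<tau> (smul r s + u) = r \<odot> x + y" by (simp add: hom_add hom_smul fl_smul s u)
  moreover have "smul r s + u \<in> nc.span S"
    using nc.span_add[OF nc.span_scale[OF nc.span_base[OF s(1)]] u(1)] .
  ultimately show ?case by blast
qed

definition "s\<^sub>0 = letter (GA 0 0 1)"
definition "s\<^sub>1 = letter (GA 1 0 1)"
definition "s\<^sub>3 = ncbr s\<^sub>0 s\<^sub>1"
text \<open>\<open>s\<^sub>2\<close> represents \<open>\<delta> (\<delta> X)\<close> rather than the second \<open>x\<close>-derivative of \<open>X\<close>, whence the correction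
  by \<open>s\<^sub>3\<close>.\<close>
definition s\<^sub>2 :: "(nat \<Rightarrow> 'k::comm_ring_1) \<Rightarrow> 'k nc" where
  "s\<^sub>2 a = smul 2 (letter (GA 2 0 1)) - smul (a 0) s\<^sub>3"

lemma s_free_lie: "s\<^sub>0 \<in> free_lie" "s\<^sub>1 \<in> free_lie" "s\<^sub>2 a \<in> free_lie" "s\<^sub>3 \<in> free_lie"
  by (simp_all add: s\<^sub>0_def s\<^sub>1_def s\<^sub>2_def s\<^sub>3_def fl_letter fl_br fl_smul free_lie_diff)

context zcr_quotient
begin

lemma vals_s: "zc.X 0 origin = \<tau> s\<^sub>0" "zc.X 1 origin = \<tau> s\<^sub>1" "zc.X (Suc 0) origin = \<tau> s\<^sub>1"
  "zc.X 2 origin = \<tau> (s\<^sub>2 a)" "zc.Y origin = \<tau> s\<^sub>3"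
  using vals_eqs
  by (simp_all add: s\<^sub>0_def s\<^sub>1_def s\<^sub>2_def s\<^sub>3_def hom_diff hom_smul fl_letter fl_smul fl_br)

lemma vals_eq: "vals = \<tau> ` {s\<^sub>0, s\<^sub>1, s\<^sub>2 a, s\<^sub>3}"
  by (simp add: vals_def vals_s)

lemma brackets_s:
  "br (\<tau> s\<^sub>0) (\<tau> s\<^sub>1) = \<tau> s\<^sub>3" "br (\<tau> s\<^sub>0) (\<tau> (s\<^sub>2 a)) = - (4 * \<alpha>) \<odot> \<tau> s\<^sub>1" "br (\<tau> s\<^sub>0) (\<tau> s\<^sub>3) = 0"
  "br (\<tau> s\<^sub>1) (\<tau> (s\<^sub>2 a)) = - (4 * \<alpha>) \<odot> \<tau> (s\<^sub>2 a)" "br (\<tau> s\<^sub>1) (\<tau> s\<^sub>3) = (4 * \<alpha>) \<odot> \<tau> s\<^sub>3"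
  "br (\<tau> (s\<^sub>2 a)) (\<tau> s\<^sub>3) = - (16 * \<alpha>\<^sup>2) \<odot> \<tau> s\<^sub>1"
  using zc.brackets[THEN fun_cong, of origin]
  unfolding ser_br_0 vals_s ser_scale_def by simp_all

end

lemma quotient_F0:
  fixes \<alpha> \<beta> :: "'k::field_char_0"
  assumes "6 * \<alpha> + \<beta> \<noteq> 0" "\<alpha> + \<beta> \<noteq> 0" "16 * \<alpha> + \<beta> \<noteq> 0"
  obtains br :: "'k nc \<Rightarrow> 'k nc \<Rightarrow> 'k nc" and \<tau> where "zcr_quotient smul br \<tau> \<alpha> \<beta> a"
    "\<And>x. x \<in> free_lie \<Longrightarrow> \<tau> x = 0 \<longleftrightarrow> x \<in> F0_ideal \<alpha> \<beta> a"
proof -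
  have "nc.subspace (F0_ideal \<alpha> \<beta> a)" unfolding F0_ideal_def by (rule subspace_lie_ideal_gen)
  from quotient_lie_algebra[OF this F0_ideal_free_lie]
  obtain br \<tau> where h: "free_lie_hom smul br \<tau>"
    and k: "\<And>x. x \<in> free_lie \<Longrightarrow> \<tau> x = 0 \<longleftrightarrow> x \<in> F0_ideal \<alpha> \<beta> a"
    using li_br unfolding F0_ideal_def by metis
  interpret free_lie_hom smul br \<tau> by (rule h)
  have "zcr_quotient smul br \<tau> \<alpha> \<beta> a"
  proof unfold_locales
    fix r assume r: "r \<in> relators \<alpha> \<beta> a"
    then have "r \<in> F0_ideal \<alpha> \<beta> a" unfolding F0_ideal_def by (rule li_rel)
    then show "\<tau> r = 0" using k r relators_free_lie by blast
  qed (rule assms)+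
  then show ?thesis using k that by blast
qed

text \<open>The spanning set of the image under \<tau> is pulled back along \<tau>, whose kernel on
  \<open>free_lie\<close> is the ideal.\<close>

lemma F0_ideal_spanning:
  fixes \<alpha> \<beta> :: "'k::field_char_0"
  assumes "6 * \<alpha> + \<beta> \<noteq> 0" "\<alpha> + \<beta> \<noteq> 0" "16 * \<alpha> + \<beta> \<noteq> 0" "x \<in> free_lie"
  shows "\<exists>u\<in>nc.span {s\<^sub>0, s\<^sub>1, s\<^sub>2 a, s\<^sub>3}. x - u \<in> F0_ideal \<alpha> \<beta> a"
proof -
  obtain br \<tau> where "zcr_quotient smul br \<tau> \<alpha> \<beta> a"
    and k: "\<And>x. x \<in> free_lie \<Longrightarrow> \<tau> x = 0 \<longleftrightarrow> x \<in> F0_ideal \<alpha> \<beta> a"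
    using quotient_F0[OF assms(1-3)] by metis
  then interpret zcr_quotient smul br \<tau> \<alpha> \<beta> a by simp
  have S: "{s\<^sub>0, s\<^sub>1, s\<^sub>2 a, s\<^sub>3} \<subseteq> free_lie" by (simp add: s_free_lie)
  obtain u where u: "u \<in> nc.span {s\<^sub>0, s\<^sub>1, s\<^sub>2 a, s\<^sub>3}" "\<tau> u = \<tau> x"
    using span_lift[OF S] hom_span[OF assms(4)] unfolding vals_eq by metis
  have "u \<in> free_lie" using nc.span_minimal[OF S subspace_free_lie] u(1) by blast
  then have "x - u \<in> F0_ideal \<alpha> \<beta> a"
    using k[of "x - u"] assms(4) u(2) by (simp add: hom_diff free_lie_diff)
  then show ?thesis using u(1) by blast
qed

lemma F0_dim_le:
  fixes \<alpha> \<beta> :: "'k::field_char_0"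
  assumes "6 * \<alpha> + \<beta> \<noteq> 0" "\<alpha> + \<beta> \<noteq> 0" "16 * \<alpha> + \<beta> \<noteq> 0"
  shows "quot_dim_le (F0_ideal \<alpha> \<beta> a) 4"
proof -
  let ?S = "{s\<^sub>0, s\<^sub>1, s\<^sub>2 a, s\<^sub>3}"
  have "card ?S \<le> length [s\<^sub>0, s\<^sub>1, s\<^sub>2 a, s\<^sub>3]"
    using card_length[of "[s\<^sub>0, s\<^sub>1, s\<^sub>2 a, s\<^sub>3]"] by simp
  moreover have "\<exists>c. x - (\<Sum>s\<in>?S. smul (c s) s) \<in> F0_ideal \<alpha> \<beta> a" if x: "x \<in> free_lie" for x
  proof -
    obtain u where "u \<in> nc.span ?S" "x - u \<in> F0_ideal \<alpha> \<beta> a"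
      using F0_ideal_spanning[OF assms x, of a] by blast
    then show ?thesis using nc.span_finite[of ?S] by auto
  qed
  ultimately show ?thesis
    unfolding quot_dim_le_def by (intro exI[of _ ?S]) (simp add: s_free_lie)
qed

text \<open>For \<alpha> = 0 the only nonzero entry of the bracket table can be [s_0, s_1] = s_3.
  Brackets lie in the span of the central element s_3, so threefold brackets vanish.\<close>

lemma F0_nilpotent:
  fixes \<beta> :: "'k::field_char_0"
  assumes "\<beta> \<noteq> 0"
  shows "quot_nilpotent (F0_ideal 0 \<beta> a)"
proof -
  obtain br \<tau> where "zcr_quotient smul br \<tau> 0 \<beta> a"
    and k: "\<And>x. x \<in> free_lie \<Longrightarrow> \<tau> x = 0 \<longleftrightarrow> x \<in> F0_ideal 0 \<beta> a"
    using quotient_F0[of 0 \<beta>] assms by auto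
  then interpret zcr_quotient smul br \<tau> 0 \<beta> a by simp
  have skew: "br (\<tau> s\<^sub>1) (\<tau> s\<^sub>0) = - \<tau> s\<^sub>3" "br (\<tau> (s\<^sub>2 a)) (\<tau> s\<^sub>0) = 0"
    "br (\<tau> (s\<^sub>2 a)) (\<tau> s\<^sub>1) = 0"
    "br (\<tau> s\<^sub>3) (\<tau> s\<^sub>0) = 0" "br (\<tau> s\<^sub>3) (\<tau> s\<^sub>1) = 0" "br (\<tau> s\<^sub>3) (\<tau> (s\<^sub>2 a)) = 0"
    using br_skew[of "\<tau> s\<^sub>1" "\<tau> s\<^sub>0"] br_skew[of "\<tau> (s\<^sub>2 a)" "\<tau> s\<^sub>0"] br_skew[of "\<tau> (s\<^sub>2 a)" "\<tau> s\<^sub>1"]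
      br_skew[of "\<tau> s\<^sub>3" "\<tau> s\<^sub>0"] br_skew[of "\<tau> s\<^sub>3" "\<tau> s\<^sub>1"] br_skew[of "\<tau> s\<^sub>3" "\<tau> (s\<^sub>2 a)"]
    by (simp_all only: brackets_s) simp_all
  have d1: "br u v \<in> nc.span {\<tau> s\<^sub>3}" if "u \<in> nc.span vals" "v \<in> nc.span vals" for u v
    using _ that
  proof (rule br_in_span)
    fix x y assume "x \<in> vals" "y \<in> vals"
    then show "br x y \<in> nc.span {\<tau> s\<^sub>3}"
      unfolding vals_eq by (auto simp: brackets_s skew nc.span_zero nc.span_base nc.span_neg)
  qed
  have d2: "br u v \<in> nc.span {}" if "u \<in> nc.span vals" "v \<in> nc.span {\<tau> s\<^sub>3}" for u v
    using _ that
  proof (rule br_in_span)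
    fix x y assume "x \<in> vals" "y \<in> {\<tau> s\<^sub>3}"
    then show "br x y \<in> nc.span {}"
      unfolding vals_eq by (auto simp: brackets_s skew)
  qed
  have "ncbr x (ncbr y z) \<in> F0_ideal 0 \<beta> a" if "x \<in> free_lie" "y \<in> free_lie" "z \<in> free_lie" for x y z
    using d2[OF hom_span[OF that(1)] d1[OF hom_span[OF that(2)] hom_span[OF that(3)]]]
      k[of "ncbr x (ncbr y z)"] that by (simp add: hom_br fl_br)
  then have "\<forall>xs. length xs = 2 + 1 \<longrightarrow> set xs \<subseteq> free_lie \<longrightarrow> nest_br xs \<in> F0_ideal 0 \<beta> a"
    by (auto simp: length_Suc_conv numeral_3_eq_3)
  then show ?thesis unfolding quot_nilpotent_def by blast
qed

section \<open>A model in two by two matrices\<close>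

lemma finite_splits_expo: "finite (splits (expo l1 l2 0))"
proof (induction l1)
  case 0
  show ?case
  proof (induction l2)
    case 0
    have "splits (\<lambda>_. 0) = {(\<lambda>_. 0, \<lambda>_. 0)}" by (auto simp: splits_def)
    then show ?case by (simp add: expo_0)
  next
    case (Suc l2)
    then show ?case using finite_splits_incr[of "expo 0 l2 0" 1] by simp
  qed
next
  case (Suc l1)
  then show ?case using finite_splits_incr[of "expo l1 l2 0" 0] by simp
qed

context lie_algebra
begin

text \<open>The Taylor series of \<open>exp (t ad w) exp (x ad z) v\<close>.\<close>
definition flow :: "'v \<Rightarrow> 'v \<Rightarrow> 'v \<Rightarrow> (nat \<Rightarrow> nat) \<Rightarrow> 'v" where
  "flow w z v e = (if \<forall>i\<ge>2. e i = 0
     then (1 / (fact (e 0) * fact (e 1))) \<odot> (br w ^^ e 1) ((br z ^^ e 0) v) else 0)"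

lemma ad_pow_linear: "(br w ^^ n) (x + y) = (br w ^^ n) x + (br w ^^ n) y"
  "(br w ^^ n) (r \<odot> x) = r \<odot> (br w ^^ n) x"
  by (induction n) (simp_all add: br_linear)

lemma flow_linear: "flow w z (x + y) = flow w z x + flow w z y"
  "flow w z (r \<odot> x) = ser_scale r (flow w z x)"
  by (auto simp: fun_eq_iff flow_def ser_scale_def ad_pow_linear scale_right_distrib)

lemma flow_minus: "flow w z (- x) = - flow w z x" and flow_zero: "flow w z 0 = 0"
  and flow_diff: "flow w z (x - y) = flow w z x - flow w z y"
proof -
  have "flow w z ((-1) \<odot> x) = ser_scale (-1) (flow w z x)" for x by (rule flow_linear)
  then show m: "flow w z (- x) = - flow w z x" for x by (simp add: fun_eq_iff ser_scale_def)
  show "flow w z (x - y) = flow w z x - flow w z y"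
    using flow_linear(1)[of w z x "- y"] by (simp add: m)
  show "flow w z 0 = 0" using flow_linear(2)[of w z 0 0] by (simp add: ser_scale_def fun_eq_iff)
qed

lemma d_flow: "2 \<le> j \<Longrightarrow> ser_d j (flow w z v) = 0"
  by (auto simp: fun_eq_iff ser_d_def flow_def)

lemma dx_flow: "ser_d 0 (flow w z v) = flow w z (br z v)"
proof
  fix e
  have "(\<forall>i\<ge>2. (incr 0 e) i = 0) = (\<forall>i\<ge>2. e i = 0)" by simp
  then show "ser_d 0 (flow w z v) e = flow w z (br z v) e"
    by (auto simp add: ser_d_def flow_def funpow_Suc_right simp del: funpow.simps of_nat_Suc)
qed

text \<open>ad w belongs to the outer exponential and acts on the value of the flow; ad z is next to
  v, so \<open>dx_flow\<close> changes the starting vector instead.\<close>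

lemma dt_flow: "ser_d 1 (flow w z v) e = br w (flow w z v e)"
proof -
  have "(\<forall>i\<ge>2. (incr 1 e) i = 0) = (\<forall>i\<ge>2. e i = 0)" by simp
  then show ?thesis
    by (auto simp add: ser_d_def flow_def br_linear simp del: of_nat_Suc)
qed

lemma flow_origin: "flow w z v (\<lambda>_. 0) = v"
  by (simp add: flow_def)

lemma ser_eq_0I:
  assumes "\<And>j. 2 \<le> j \<Longrightarrow> ser_d j S = 0" "\<And>l1 l2. S (expo l1 l2 0) = 0"
  shows "S = 0"
proof
  fix e
  show "S e = (0 :: (nat \<Rightarrow> nat) \<Rightarrow> 'v) e"
  proof (cases "\<forall>i\<ge>2. e i = 0")
    case True
    then have "e = expo (e 0) (e 1) 0" by (intro expo_eqI) blast
    then show ?thesis using assms(2)[of "e 0" "e 1"] by simp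
  next
    case False
    then obtain i where "2 \<le> i" "e i \<noteq> 0" by blast
    then show ?thesis using ser_d_zeroD[OF assms(1), of i e] by simp
  qed
qed

text \<open>Exponentials of inner derivations are automorphisms. The defect \<open>R\<close>
  satisfies the linear equations of a flow and vanishes at the origin, so all its coefficients
  vanish by induction.\<close>

lemma flow_br: "ser_br (flow w z x) (flow w z y) = flow w z (br x y)"
proof -
  define R where "R x y = ser_br (flow w z x) (flow w z y) - flow w z (br x y)" for x y
  interpret c: zcr_calculus ser_scale ser_br "ser_d 0" "ser_d (Suc 0)" ser_du "ser_m (\<lambda>_. 0)"
    by (rule zcr_calculus_ser)
  have dx: "ser_d 0 (R x y) = R (br z x) y + R x (br z y)" for x y
    using jacobi[of z x y]
    by (simp add: R_def c.dx_br dx_flow flow_linear)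
  have dt: "ser_d 1 (R x y) e = br w (R x y e)" for x y e
  proof -
    have "ser_d 1 (ser_br (flow w z x) (flow w z y)) e
      = (\<Sum>(p, q)\<in>splits e. br (br w (flow w z x p)) (flow w z y q) + br (flow w z x p) (br w (flow w z y q)))"
      unfolding ser_d_br by (simp add: ser_br_def dt_flow sum.distrib case_prod_unfold del: One_nat_def)
    also have "\<dots> = br w (ser_br (flow w z x) (flow w z y) e)"
      unfolding ser_br_def br_sum_right by (intro sum.cong) (auto simp: jacobi[of w])
    finally show ?thesis
      using dt_flow[of w z "br x y" e] by (simp add: R_def br_linear)
  qed
  have coeff: "R x y (expo l1 l2 0) = 0" for l1 l2
  proof (induction l1 arbitrary: x y)
    case 0
    show ?case
    proof (induction l2)
      case 0
      show ?case by (simp add: R_def expo_0 ser_br_0 flow_origin)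
    next
      case (Suc l2)
      have "of_nat (Suc l2) \<odot> R x y (expo 0 (Suc l2) 0) = ser_d 1 (R x y) (expo 0 l2 0)"
        by (simp add: ser_d_def)
      then have "of_nat (Suc l2) \<odot> R x y (expo 0 (Suc l2) 0) = 0" by (simp only: dt Suc br_zero)
      then show ?case by (simp only: scale_eq_0_iff of_nat_eq_0_iff) simp
    qed
  next
    case (Suc l1)
    have "of_nat (Suc l1) \<odot> R x y (expo (Suc l1) l2 0) = ser_d 0 (R x y) (expo l1 l2 0)"
      by (simp add: ser_d_def)
    then have "of_nat (Suc l1) \<odot> R x y (expo (Suc l1) l2 0) = 0" by (simp add: dx Suc del: of_nat_Suc)
    then show ?case by (simp only: scale_eq_0_iff of_nat_eq_0_iff) simp
  qed
  have "ser_d j (R x y) = 0" if "2 \<le> j" for j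
  proof -
    have "j - 2 + 2 = j" using that by simp
    then have j: "ser_d j = ser_du (j - 2)" by (simp add: ser_du_def)
    have "ser_du (j - 2) (flow w z v) = 0" for v unfolding j[symmetric] using that by (rule d_flow)
    then show ?thesis unfolding j R_def by (simp add: c.d_br)
  qed
  from ser_eq_0I[OF this coeff] have "R x y = 0" .
  then show ?thesis by (simp add: R_def)
qed

definition const :: "'v \<Rightarrow> (nat \<Rightarrow> nat) \<Rightarrow> 'v" where
  "const v e = (if \<forall>i. e i = 0 then v else 0)"

lemma d_const: "ser_d j (const v) = 0"
  by (auto simp: fun_eq_iff ser_d_def const_def)

lemma const_br_flow: "ser_br (const u) (flow w z v) e = br u (flow w z v e)"
proof (cases "finite (splits e)")
  case True
  have "ser_br (const u) (flow w z v) e = (\<Sum>(p, q)\<in>{(\<lambda>_. 0, e)}. br (const u p) (flow w z v q))"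
    unfolding ser_br_def
  proof (rule sum.mono_neutral_right[OF True])
    show "\<forall>i\<in>splits e - {(\<lambda>_. 0, e)}. (case i of (p, q) \<Rightarrow> br (const u p) (flow w z v q)) = 0"
    proof
      fix x assume x: "x \<in> splits e - {(\<lambda>_. 0, e)}"
      obtain p q where xpq: "x = (p, q)" by (cases x)
      with x have pq: "(p, q) \<in> splits e" "p = (\<lambda>_. 0) \<longrightarrow> q \<noteq> e" by auto
      have "\<not> (\<forall>i. p i = 0)"
      proof
        assume "\<forall>i. p i = 0"
        then have "p = (\<lambda>_. 0)" by auto
        then show False using pq by (simp add: splits_iff)
      qed
      then show "(case x of (p, q) \<Rightarrow> br (const u p) (flow w z v q)) = 0" by (auto simp: xpq const_def)
    qed
  qed (auto simp: splits_def)
  then show ?thesis by (simp add: const_def)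
next
  case False
  \<comment> \<open>The convolution is 0 by default when \<open>splits e\<close> is infinite; e then
    involves more than x and t, where the flow vanishes too.\<close>
  have "flow w z v e = 0"
  proof (cases "\<forall>i\<ge>2. e i = 0")
    case True
    then have "e = expo (e 0) (e 1) 0" by (intro expo_eqI) blast
    then show ?thesis using False finite_splits_expo by metis
  next
    case False
    then show ?thesis by (auto simp: flow_def)
  qed
  then show ?thesis using False by (simp add: ser_br_def)
qed

end

section \<open>A solution normalised at a, generated from constants\<close>

locale zcr_seed = lie_algebra scale br
  for scale :: "'k::field_char_0 \<Rightarrow> 'v::ab_group_add \<Rightarrow> 'v" (infixr "\<odot>" 75)
    and br :: "'v \<Rightarrow> 'v \<Rightarrow> 'v" +
  fixes \<alpha> \<beta> :: 'k and a :: "nat \<Rightarrow> 'k" and x\<^sub>0 x\<^sub>1 x\<^sub>2 y z :: 'v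
  assumes brackets: "br x\<^sub>0 x\<^sub>1 = y" "br x\<^sub>0 x\<^sub>2 = - (4 * \<alpha>) \<odot> x\<^sub>1" "br x\<^sub>0 y = 0"
    and z: "br z x\<^sub>0 = x\<^sub>1" "br z x\<^sub>1 = x\<^sub>2" "br z x\<^sub>2 = 0" "br z y = - (4 * \<alpha>) \<odot> x\<^sub>1"
begin

text \<open>The constant counterpart of \<open>G\<close>. Taking H = -w makes B vanish at x = x_a,
  u_k = a_k.\<close>

definition "w = a 4 \<odot> x\<^sub>0 - a 3 \<odot> x\<^sub>1 + a 2 \<odot> (x\<^sub>2 + a 0 \<odot> y) + (8 * \<alpha> - 2 * \<beta>) \<odot> a 0 \<odot> a 2 \<odot> x\<^sub>0
   + (2 * \<beta>) \<odot> a 0 \<odot> a 1 \<odot> x\<^sub>1 - (1/2) \<odot> a 1 \<odot> a 1 \<odot> (y + (4 * \<alpha> + 4 * \<beta>) \<odot> x\<^sub>0)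
   - \<beta> \<odot> a 0 \<odot> a 0 \<odot> x\<^sub>2 - (1/3) \<odot> a 0 \<odot> a 0 \<odot> a 0 \<odot> ((2 * \<beta>) \<odot> y + (20 * \<alpha> * \<beta>) \<odot> x\<^sub>0)"

text \<open>In the model Z is -a_0 T x_0 and \<delta> acts on T v as T (ad z v); the plain
  x-derivative is therefore induced by ad (z + a_0 x_0).\<close>

definition "z' = z + a 0 \<odot> x\<^sub>0"

abbreviation "T \<equiv> flow w z'"

definition "model_A = ser_m a 0 (T x\<^sub>0) + (- ser_scale (a 0) (T x\<^sub>0))"
definition "model_B = ser_m a 4 (T x\<^sub>0) - ser_m a 3 (T x\<^sub>1) + ser_m a 2 (T x\<^sub>2 + ser_m a 0 (T y))
   + ser_scale (8 * \<alpha> - 2 * \<beta>) (ser_m a 0 (ser_m a 2 (T x\<^sub>0)))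
   + ser_scale (2 * \<beta>) (ser_m a 0 (ser_m a 1 (T x\<^sub>1)))
   - ser_scale (1/2) (ser_m a 1 (ser_m a 1 (T y + ser_scale (4 * \<alpha> + 4 * \<beta>) (T x\<^sub>0))))
   - ser_scale \<beta> (ser_m a 0 (ser_m a 0 (T x\<^sub>2)))
   - ser_scale (1/3) (ser_m a 0 (ser_m a 0 (ser_m a 0
      (ser_scale (2 * \<beta>) (T y) + ser_scale (20 * \<alpha> * \<beta>) (T x\<^sub>0))))) + (- const w)"

sublocale c: zcr_calculus ser_scale ser_br "ser_d 0" "ser_d (Suc 0)" ser_du "ser_m a"
  by (rule zcr_calculus_ser)

lemma T_brackets: "ser_br (T x\<^sub>0) (T x\<^sub>1) = T y" "ser_br (T x\<^sub>0) (T x\<^sub>2) = ser_scale (- (4 * \<alpha>)) (T x\<^sub>1)"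
  "ser_br (T x\<^sub>0) (T y) = 0"
  by (simp_all only: flow_br brackets flow_linear flow_zero)

lemma du_T: "ser_du k (T v) = 0"
  unfolding ser_du_def by (rule d_flow) simp

lemma dt_T: "ser_d (Suc 0) (T v) = ser_br (const w) (T v)"
  using dt_flow[of w z' v] by (simp add: fun_eq_iff const_br_flow)

lemma dx_T: "ser_d 0 (T v) = T (br z v) + ser_scale (a 0) (ser_br (T x\<^sub>0) (T v))"
  by (simp add: dx_flow z'_def br_linear flow_linear flow_br)

lemma model_zcr: "ser_d 0 model_B + ser_m a 1 (ser_du 0 model_B) + ser_m a 2 (ser_du 1 model_B)
   + ser_m a 3 (ser_du 2 model_B) + ser_m a 4 (ser_du 3 model_B) + ser_m a 5 (ser_du 4 model_B)
   + ser_br model_A model_B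
   = ser_d (Suc 0) model_A + ser_m a 5 (ser_du 0 model_A)
   + ser_scale (4 * \<alpha> - 6 * \<beta>) (ser_m a 1 (ser_m a 2 (ser_du 0 model_A)))
   + ser_scale (8 * \<alpha> - 2 * \<beta>) (ser_m a 0 (ser_m a 3 (ser_du 0 model_A)))
   - ser_scale (20 * \<alpha> * \<beta>) (ser_m a 0 (ser_m a 0 (ser_m a 1 (ser_du 0 model_A))))"
  unfolding model_A_def model_B_def
proof (rule c.zcr_model)
  have dc: "ser_d j (const w) = 0" for j by (rule d_const)
  have dcu: "ser_du k (const w) = 0" for k unfolding ser_du_def by (rule d_const)
  then show "ser_du k (- const w) = 0" for k by simp
  show "ser_du k (- ser_scale (a 0) (T x\<^sub>0)) = 0" for k by (simp add: du_T)
  show "ser_d 0 (T x\<^sub>0) = T x\<^sub>1 - ser_br (- ser_scale (a 0) (T x\<^sub>0)) (T x\<^sub>0)"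
    "ser_d 0 (T x\<^sub>1) = T x\<^sub>2 - ser_br (- ser_scale (a 0) (T x\<^sub>0)) (T x\<^sub>1)"
    "ser_d 0 (T x\<^sub>2) = - ser_br (- ser_scale (a 0) (T x\<^sub>0)) (T x\<^sub>2)"
    "ser_d 0 (T y) = ser_scale (- (4 * \<alpha>)) (T x\<^sub>1) - ser_br (- ser_scale (a 0) (T x\<^sub>0)) (T y)"
    by (simp_all only: dx_T z flow_zero flow_linear c.br_linear) simp_all
  show "ser_d (Suc 0) (T x\<^sub>0) = - ser_br (- const w) (T x\<^sub>0)"
    by (simp add: dt_T c.br_linear)
  \<comment> \<open>Flatness of the pair Z, H: w is constant, and Z evolves by ad w.\<close>
  show "ser_d 0 (- const w) = ser_d (Suc 0) (- ser_scale (a 0) (T x\<^sub>0))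
      - ser_br (- ser_scale (a 0) (T x\<^sub>0)) (- const w)"
    using c.br_skew[of "const w" "T x\<^sub>0"] by (simp add: dc dt_T c.br_linear)
qed (simp_all only: T_brackets du_T)

lemma model_A_eq: "model_A = ser_var 2 (T x\<^sub>0)"
  by (simp add: model_A_def ser_m_alt numeral_2_eq_2)

lemma d_model_A: "3 \<le> j \<Longrightarrow> ser_d j model_A = 0"
proof -
  have "ser_var 2 0 = 0" by (simp add: ser_var_def fun_eq_iff)
  then show "3 \<le> j \<Longrightarrow> ser_d j model_A = 0" by (simp add: model_A_eq ser_var_d d_flow)
qed

lemma d_model_B:
  assumes "7 \<le> j"
  shows "ser_d j model_B = 0"
proof -
  define k where "k = j - 2"
  have "j = k + 2" using assms by (simp add: k_def)
  then have j: "ser_d j = ser_du k" by (simp add: ser_du_def)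
  have k: "k \<noteq> 0" "k \<noteq> Suc 0" "k \<noteq> 2" "k \<noteq> 3" "k \<noteq> 4" using assms by (simp_all add: k_def)
  have "ser_du k (const w) = 0" unfolding ser_du_def by (rule d_const)
  then show ?thesis unfolding j model_B_def by (simp add: du_T k)
qed

lemma model_A_0: "e 2 = 0 \<Longrightarrow> model_A e = 0"
  by (simp add: model_A_eq ser_var_def)

lemma model_A_1: "model_A (expo l1 l2 1) = T x\<^sub>0 (expo l1 l2 0)"
proof -
  have "(expo l1 l2 1)(2 := 0) = expo l1 l2 0" by (auto simp: expo_def)
  then show ?thesis by (simp add: model_A_eq ser_var_def)
qed

text \<open>At x = x_a, u_k = a_k the series B equals T w - w, and T w stays equal to w along t
  because [w, w] = 0.\<close>

lemma model_B_0:
  assumes "\<And>i. 2 \<le> i \<Longrightarrow> e i = 0" "e 0 = 0"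
  shows "model_B e = 0"
proof -
  have m: "ser_m a k S e = a k \<odot> S e" for k S
    using assms by (intro ser_m_eval) simp
  have "model_B e = T w e - const w e"
    unfolding w_def flow_linear flow_diff
    by (simp add: model_B_def w_def m ser_scale_def scale_right_distrib)
  also have "T w e = const w e"
  proof (cases "e 1")
    case 0
    have "e i = 0" for i using 0 assms(1)[of i] assms(2) by (cases "i = 0"; cases "i = 1") auto
    then have "e = (\<lambda>_. 0)" by auto
    then show ?thesis by (simp add: flow_origin const_def)
  next
    case (Suc n)
    have "(br w ^^ Suc n) w = 0" by (simp add: funpow_Suc_right del: funpow.simps) (induction n, simp_all)
    then have "T w e = 0" using assms Suc by (simp add: flow_def)
    moreover have "const w e = 0" using Suc by (auto simp: const_def)
    ultimately show ?thesis by simp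
  qed
  finally show ?thesis by simp
qed

end

section \<open>Evaluation of noncommutative polynomials at matrices\<close>

definition mscale :: "'k::comm_ring_1 \<Rightarrow> 'k^2^2 \<Rightarrow> 'k^2^2" where
  "mscale r M = (\<chi> i j. r * M $ i $ j)"

definition commutator :: "'k::comm_ring_1^2^2 \<Rightarrow> 'k^2^2 \<Rightarrow> 'k^2^2" where
  "commutator M N = M ** N - N ** M"

definition mat2 :: "'k \<Rightarrow> 'k \<Rightarrow> 'k \<Rightarrow> 'k \<Rightarrow> 'k^2^2" where
  "mat2 a b c d = (\<chi> i j. if i = 1 then if j = 1 then a else b else if j = 1 then c else d)"

lemma mat2_nth [simp]: "mat2 a b c d $ 1 $ 1 = a" "mat2 a b c d $ 1 $ 2 = b"
  "mat2 a b c d $ 2 $ 1 = c" "mat2 a b c d $ 2 $ 2 = d"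
  by (simp_all add: mat2_def)

lemmas mat2_entries = vec_eq_iff forall_2 sum_2 matrix_matrix_mult_def mscale_def commutator_def
  mat_def trace_def

interpretation gl2: lie_algebra "mscale :: 'k::field_char_0 \<Rightarrow> _" commutator
  by unfold_locales (simp_all add: mat2_entries algebra_simps)

definition word_value :: "(gen \<Rightarrow> 'k::comm_ring_1^2^2) \<Rightarrow> gen list \<Rightarrow> 'k^2^2" where
  "word_value \<rho> w = foldr (\<lambda>g M. \<rho> g ** M) w (mat 1)"

lemma word_value_append: "word_value \<rho> (u @ v) = word_value \<rho> u ** word_value \<rho> v"
  by (induction u) (simp_all add: word_value_def matrix_mul_assoc)

abbreviation supp :: "'k::comm_ring_1 nc \<Rightarrow> gen list set" where
  "supp x \<equiv> {w. x w \<noteq> 0}"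

text \<open>A function on words may have infinite support, and the sum then defaults to 0. The laws
  below assume finite support, which holds throughout \<open>free_lie\<close>.\<close>

definition eval_nc :: "(gen \<Rightarrow> 'k::comm_ring_1^2^2) \<Rightarrow> 'k nc \<Rightarrow> 'k^2^2" where
  "eval_nc \<rho> x = (\<Sum>w\<in>supp x. mscale (x w) (word_value \<rho> w))"

lemma mscale_simps:
  fixes M N K :: "'k::comm_ring_1^2^2"
  shows "mscale 0 M = 0" "mscale r (M + N) = mscale r M + mscale r N"
  "mscale (r + s) M = mscale r M + mscale s M" "mscale r (mscale s M) = mscale (r * s) M"
  "mscale r M ** mscale s N = mscale (r * s) (M ** N)" "0 ** M = 0" "M ** 0 = 0"
  "(M + N) ** K = M ** K + N ** K"
  by (simp_all add: mat2_entries algebra_simps)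

lemma eval_nc_superset:
  assumes "finite W" "supp x \<subseteq> W"
  shows "eval_nc \<rho> x = (\<Sum>w\<in>W. mscale (x w) (word_value \<rho> w))"
  unfolding eval_nc_def using assms by (intro sum.mono_neutral_left) (auto simp: mscale_simps)

lemma eval_nc_add:
  assumes "finite (supp x)" "finite (supp y)"
  shows "eval_nc \<rho> (x + y) = eval_nc \<rho> x + eval_nc \<rho> y"
proof -
  let ?W = "supp x \<union> supp y"
  have "finite ?W" using assms by simp
  then show ?thesis
    by (subst (1 2 3) eval_nc_superset[of ?W]) (auto simp: mscale_simps sum.distrib)
qed

lemma mscale_sum: "mscale r (\<Sum>i\<in>I. f i) = (\<Sum>i\<in>I. mscale r (f i))"
  by (simp add: mat2_entries sum_distrib_left)

lemma eval_nc_smul: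
  assumes "finite (supp x)"
  shows "eval_nc \<rho> (smul r x) = mscale r (eval_nc \<rho> x)"
  by (subst (1 2) eval_nc_superset[OF assms]) (auto simp: smul_def mscale_simps mscale_sum)

lemma matrix_sum_mult:
  fixes f :: "'i \<Rightarrow> 'k::comm_ring_1^2^2" and g :: "'j \<Rightarrow> 'k^2^2"
  shows "(\<Sum>i\<in>I. f i) ** (\<Sum>j\<in>J. g j) = (\<Sum>(i, j)\<in>I \<times> J. f i ** g j)"
proof -
  have l: "(\<Sum>i\<in>I. f i) ** N = (\<Sum>i\<in>I. f i ** N)" for N :: "'k^2^2"
    by (induction I rule: infinite_finite_induct) (simp_all add: mscale_simps)
  have r: "M ** (\<Sum>j\<in>J. g j) = (\<Sum>j\<in>J. M ** g j)" for M :: "'k^2^2"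
    by (induction J rule: infinite_finite_induct) (simp_all add: matrix_add_ldistrib mscale_simps)
  show ?thesis unfolding l by (simp only: r sum.cartesian_product)
qed

lemma supp_ncmul: "supp (ncmul x y) \<subseteq> (\<lambda>(u, v). u @ v) ` (supp x \<times> supp y)"
proof
  fix w assume "w \<in> supp (ncmul x y)"
  then have "(\<Sum>(u, v)\<in>cuts w. x u * y v) \<noteq> 0" by (simp add: ncmul_eq)
  then obtain p where "p \<in> cuts w" "(case p of (u, v) \<Rightarrow> x u * y v) \<noteq> 0"
    by (meson sum.neutral)
  then obtain u v where "u @ v = w" "x u * y v \<noteq> 0" by (auto simp: cuts_def)
  then show "w \<in> (\<lambda>(u, v). u @ v) ` (supp x \<times> supp y)" by (force simp: image_def)
qed

text \<open>Pairs of a word and one of its cuts are reindexed by pairs of words from the two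
  supports; all other cuts contribute 0.\<close>

lemma eval_nc_mult:
  assumes "finite (supp x)" "finite (supp y)"
  shows "eval_nc \<rho> (ncmul x y) = eval_nc \<rho> x ** eval_nc \<rho> y"
proof -
  define W where "W = (\<lambda>(u, v). u @ v) ` (supp x \<times> supp y)"
  define F where "F p = mscale (x (fst p) * y (snd p)) (word_value \<rho> (fst p) ** word_value \<rho> (snd p))" for p
  have W: "finite W" using assms by (simp add: W_def)
  have "eval_nc \<rho> (ncmul x y) = (\<Sum>w\<in>W. mscale (ncmul x y w) (word_value \<rho> w))"
    using supp_ncmul W unfolding W_def by (intro eval_nc_superset) auto
  also have "\<dots> = (\<Sum>w\<in>W. \<Sum>p\<in>cuts w. F p)"
  proof (intro sum.cong refl)
    fix w
    have lin: "mscale (\<Sum>p\<in>I. f p) M = (\<Sum>p\<in>I. mscale (f p) M)"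
      for f :: "gen list \<times> gen list \<Rightarrow> 'a" and I M
      by (induction I rule: infinite_finite_induct) (simp_all add: mscale_simps)
    show "mscale (ncmul x y w) (word_value \<rho> w) = (\<Sum>p\<in>cuts w. F p)"
      unfolding ncmul_eq lin F_def
      by (intro sum.cong refl) (auto simp: cuts_def word_value_append)
  qed
  also have "\<dots> = (\<Sum>q\<in>Sigma W cuts. F (snd q))"
    using W by (simp add: sum.Sigma case_prod_unfold)
  also have "\<dots> = (\<Sum>q\<in>(\<lambda>(u, v). (u @ v, (u, v))) ` (supp x \<times> supp y). F (snd q))"
  proof (rule sum.mono_neutral_right)
    show "\<forall>q\<in>Sigma W cuts - (\<lambda>(u, v). (u @ v, (u, v))) ` (supp x \<times> supp y). F (snd q) = 0"
    proof
      fix q assume "q \<in> Sigma W cuts - (\<lambda>(u, v). (u @ v, (u, v))) ` (supp x \<times> supp y)"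
      moreover obtain w u v where "q = (w, (u, v))" by (metis prod.exhaust)
      ultimately have "x u * y v = 0" "q = (w, (u, v))" by (auto simp: cuts_def image_def)
      then show "F (snd q) = 0" by (simp add: F_def mscale_simps)
    qed
    show "finite (Sigma W cuts)" using W by (intro finite_SigmaI) auto
  qed (auto simp: W_def cuts_def)
  also have "\<dots> = (\<Sum>(u, v)\<in>supp x \<times> supp y. F (u, v))"
    by (subst sum.reindex) (auto simp: inj_on_def case_prod_unfold)
  also have "\<dots> = eval_nc \<rho> x ** eval_nc \<rho> y"
    by (simp add: eval_nc_def matrix_sum_mult F_def mscale_simps)
  finally show ?thesis .
qed

lemma finite_supp:
  "finite (supp x) \<Longrightarrow> finite (supp y) \<Longrightarrow> finite (supp (x + y))"
  "finite (supp x) \<Longrightarrow> finite (supp y) \<Longrightarrow> finite (supp (x - y))"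
  "finite (supp x) \<Longrightarrow> finite (supp (smul r x))"
  "finite (supp x) \<Longrightarrow> finite (supp y) \<Longrightarrow> finite (supp (ncmul x y))"
proof -
  assume f: "finite (supp x)"
  show "finite (supp (smul r x))" by (rule finite_subset[OF _ f]) (auto simp: smul_def)
  assume g: "finite (supp y)"
  have u: "finite (supp x \<union> supp y)" using f g by simp
  show "finite (supp (x + y))" "finite (supp (x - y))"
    by (rule finite_subset[OF _ u]; auto)+
  show "finite (supp (ncmul x y))" by (rule finite_subset[OF supp_ncmul]) (simp add: f g)
qed

lemma eval_nc_diff:
  assumes "finite (supp x)" "finite (supp y)"
  shows "eval_nc \<rho> (x - y) = eval_nc \<rho> x - eval_nc \<rho> y"
  using eval_nc_add[of "x - y" y \<rho>] finite_supp(2)[OF assms] assms(2) by simp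

lemma eval_letter: "eval_nc \<rho> (letter g) = \<rho> g"
proof -
  have "supp (letter g :: 'a nc) = {[g]}" by (auto simp: letter_def)
  then show ?thesis by (simp add: eval_nc_def letter_def word_value_def) (simp add: mat2_entries)
qed

lemma free_lie_finite_supp: "x \<in> free_lie \<Longrightarrow> finite (supp x)"
proof (induction rule: free_lie.induct)
  case (fl_letter g)
  show ?case by (rule finite_subset[of _ "{[g]}"]) (auto simp: letter_def)
next
  case (fl_br x y)
  then show ?case unfolding ncbr_def by (intro finite_supp)
next
  case (fl_add x y)
  then show ?case by (intro finite_supp)
qed (simp_all add: finite_supp)

lemma eval_nc_hom: "free_lie_hom mscale commutator (eval_nc (\<rho> :: gen \<Rightarrow> 'k::field_char_0^2^2))"
proof unfold_locales
  fix x y :: "'k nc" assume "x \<in> free_lie" "y \<in> free_lie"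
  then have f: "finite (supp x)" "finite (supp y)" by (simp_all add: free_lie_finite_supp)
  show "eval_nc \<rho> (x + y) = eval_nc \<rho> x + eval_nc \<rho> y" by (rule eval_nc_add[OF f])
  have "eval_nc \<rho> (ncmul x y - ncmul y x) = eval_nc \<rho> (ncmul x y) - eval_nc \<rho> (ncmul y x)"
    by (intro eval_nc_diff finite_supp f)
  then show "eval_nc \<rho> (ncbr x y) = commutator (eval_nc \<rho> x) (eval_nc \<rho> y)"
    unfolding ncbr_def commutator_def by (simp only: eval_nc_mult f)
qed (simp add: eval_nc_smul free_lie_finite_supp)

locale gl2_model =
  fixes \<alpha> \<beta> :: "'k::field_char_0" and a :: "nat \<Rightarrow> 'k"
  assumes \<alpha>: "\<alpha> \<noteq> 0"
begin

text \<open>The brackets of the spanning set say that \<open>X\<^sub>1 / (2 \<alpha>)\<close>, \<open>Y\<close>, \<open>X\<^sub>2 / (32 \<alpha>\<^sup>3)\<close> is an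
  \<open>sl\<^sub>2\<close>-triple and that \<open>X\<^sub>0 + Y / (4 \<alpha>)\<close> is central; \<open>Z\<close> makes the derivation \<open>\<delta>\<close> inner.\<close>
definition "X\<^sub>0 = mat2 1 (- 1 / (4 * \<alpha>)) 0 1"
definition "X\<^sub>1 = mat2 (2 * \<alpha>) 0 0 (- 2 * \<alpha>)"
definition "X\<^sub>2 = mat2 0 0 (32 * \<alpha> ^ 3) 0"
definition "Y = mat2 0 1 0 (0::'k)"
definition "Z = mat2 0 0 (8 * \<alpha>\<^sup>2) 0"

sublocale seed: zcr_seed mscale commutator \<alpha> \<beta> a X\<^sub>0 X\<^sub>1 X\<^sub>2 Y Z
  using \<alpha> by unfold_locales
    (simp_all add: X\<^sub>0_def X\<^sub>1_def X\<^sub>2_def Y_def Z_def mat2_entries power2_eq_square power3_eq_cube)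

text \<open>Each generator is sent to its coefficient in the model, so that the evaluated series
  \<open>ev.\<A>\<close> and \<open>ev.\<B>\<close> give the model back.\<close>

definition \<rho> :: "gen \<Rightarrow> 'k^2^2" where
  "\<rho> g = (case g of GA l1 l2 i \<Rightarrow> seed.model_A (expo l1 l2 i)
     | GB l1 l2 j0 j1 j2 j3 j4 \<Rightarrow> seed.model_B
         (\<lambda>n. if n < 7 then [l1, l2, j0, j1, j2, j3, j4] ! n else 0))"

abbreviation "ev \<equiv> eval_nc \<rho>"

sublocale ev: free_lie_hom mscale commutator ev
  by (rule eval_nc_hom)

lemma A_eq: "ev.\<A> = seed.model_A"
proof
  fix e
  show "ev.\<A> e = seed.model_A e"
  proof (cases "\<forall>i\<ge>3. e i = 0")
    case True
    then have "expo (e 0) (e 1) (e 2) = e"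
      by (auto simp: expo_def fun_eq_iff)
    then show ?thesis using True by (simp add: ev.ser_hom_def Aser_def eval_letter \<rho>_def)
  next
    case False
    then obtain i where i: "3 \<le> i" "e i \<noteq> 0" by blast
    then have "seed.model_A e = 0" using gl2.ser_d_zeroD[OF seed.d_model_A[OF i(1)], of e] by simp
    then show ?thesis using False by (auto simp: ev.ser_hom_def Aser_def ev.hom_zero)
  qed
qed

lemma B_eq: "ev.\<B> = seed.model_B"
proof
  fix e
  show "ev.\<B> e = seed.model_B e"
  proof (cases "\<forall>i\<ge>7. e i = 0")
    case True
    have "(\<lambda>n. if n < 7 then [e 0, e (Suc 0), e 2, e 3, e 4, e 5, e 6] ! n else 0) = e"
    proof
      fix n :: nat
      have "n < 7 \<Longrightarrow> n = 0 \<or> n = 1 \<or> n = 2 \<or> n = 3 \<or> n = 4 \<or> n = 5 \<or> n = 6" by arith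
      then show "(if n < 7 then [e 0, e (Suc 0), e 2, e 3, e 4, e 5, e 6] ! n else 0) = e n"
        using True by auto
    qed
    then show ?thesis using True by (simp add: ev.ser_hom_def Bser_def eval_letter \<rho>_def)
  next
    case False
    then obtain i where i: "7 \<le> i" "e i \<noteq> 0" by blast
    then have "seed.model_B e = 0" using gl2.ser_d_zeroD[OF seed.d_model_B[OF i(1)], of e] by simp
    then show ?thesis using False by (auto simp: ev.ser_hom_def Bser_def ev.hom_zero)
  qed
qed

lemma defect: "ev.zcr_defect \<alpha> \<beta> a = 0"
  using seed.model_zcr unfolding ev.zcr_defect_def A_eq B_eq gl2.ser_du_def
  by (simp add: eval_nat_numeral)

lemma ev_relators:
  assumes "r \<in> relators \<alpha> \<beta> a"
  shows "ev r = 0"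
proof -
  consider e where "r = DxB a e - DtA \<alpha> \<beta> a e + sbr Aser Bser e"
    | l1 l2 where "r = letter (GA l1 l2 0)" | l2 where "r = letter (GB 0 l2 0 0 0 0 0)"
    using assms by (auto simp: relators_def)
  then show ?thesis
  proof cases
    case 1
    then show ?thesis using ev.hom_relator[of a e \<alpha> \<beta>] by (simp only: defect zero_fun_apply)
  next
    case 2
    then show ?thesis by (simp add: eval_letter \<rho>_def seed.model_A_0)
  next
    case 3
    have "[0, l2, 0, 0, 0, 0, 0] ! n = 0" if "2 \<le> n" "n < 7" for n :: nat
    proof -
      have "n = 2 \<or> n = 3 \<or> n = 4 \<or> n = 5 \<or> n = 6" using that by arith
      then show ?thesis by auto
    qed
    then show ?thesis unfolding 3 by (simp add: eval_letter \<rho>_def seed.model_B_0)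
  qed
qed

lemma ev_ideal:
  assumes "x \<in> F0_ideal \<alpha> \<beta> a"
  shows "ev x = 0"
proof -
  have "x \<in> lie_ideal_gen (relators \<alpha> \<beta> a)" using assms by (simp add: F0_ideal_def)
  \<comment> \<open>Membership in \<open>free_lie\<close> is carried through the induction because
    the homomorphism laws of \<open>ev\<close> hold there.\<close>
  then have "x \<in> free_lie \<and> ev x = 0"
  proof (induction rule: lie_ideal_gen.induct)
    case (li_rel r)
    then show ?case using ev_relators relators_free_lie by blast
  next
    case li_zero
    have "(0 :: 'k nc) \<in> free_lie \<and> ev 0 = 0" by (simp add: fl_zero ev.hom_zero)
    then show ?case by (simp only: zero_fun_def)
  next
    case (li_add x y)
    then have "x + y \<in> free_lie \<and> ev (x + y) = 0" by (simp add: fl_add ev.hom_add)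
    then show ?case by (simp only: plus_fun_def)
  next
    case (li_smul x c)
    then show ?case by (simp add: fl_smul ev.hom_smul)
  next
    case (li_br x y)
    then show ?case by (simp add: fl_br ev.hom_br)
  qed
  then show ?thesis by blast
qed

lemma ev_s: "ev s\<^sub>0 = X\<^sub>0" "ev s\<^sub>1 = X\<^sub>1" "ev s\<^sub>3 = Y" "ev (s\<^sub>2 a) = X\<^sub>2"
proof -
  have "expo l1 0 0 i = 0" if "2 \<le> i" for l1 i using that by (simp add: expo_def)
  \<comment> \<open>The flow of X_0 in x has Taylor coefficients ad(z')^l / l!, applied to
    X_0.\<close>
  then have A: "ev (letter (GA l1 0 1)) = mscale (1 / fact l1) ((commutator seed.z' ^^ l1) X\<^sub>0)" for l1
    using seed.model_A_1[of l1 0] by (simp add: eval_letter \<rho>_def gl2.flow_def)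
  have z0: "commutator seed.z' X\<^sub>0 = X\<^sub>1"
    by (simp add: seed.z'_def gl2.br_linear seed.z)
  have z1: "commutator seed.z' X\<^sub>1 = X\<^sub>2 + mscale (a 0) Y"
    by (simp add: seed.z'_def gl2.br_linear seed.z seed.brackets)
  show 0: "ev s\<^sub>0 = X\<^sub>0" and 1: "ev s\<^sub>1 = X\<^sub>1"
    unfolding s\<^sub>0_def s\<^sub>1_def A by (simp_all add: z0)
  show 3: "ev s\<^sub>3 = Y"
    unfolding s\<^sub>3_def by (simp add: ev.hom_br s_free_lie 0 1 seed.brackets)
  have 2: "ev (letter (GA 2 0 1)) = mscale (1 / 2) (X\<^sub>2 + mscale (a 0) Y)"
    unfolding A by (simp add: numeral_2_eq_2 z0 z1)
  have "ev (s\<^sub>2 a) = mscale 2 (ev (letter (GA 2 0 1))) - mscale (a 0) (ev s\<^sub>3)"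
    unfolding s\<^sub>2_def by (simp add: ev.hom_diff ev.hom_smul fl_letter fl_smul s_free_lie)
  then show "ev (s\<^sub>2 a) = X\<^sub>2" unfolding 2 3 by simp
qed

text \<open>Modulo the ideal, x is a combination u of the four spanning elements. Their images are
  linearly independent matrices, so \<open>ev u = 0\<close> forces u = 0.\<close>

lemma ev_kernel:
  assumes nonexc: "6 * \<alpha> + \<beta> \<noteq> 0" "\<alpha> + \<beta> \<noteq> 0" "16 * \<alpha> + \<beta> \<noteq> 0" and x: "x \<in> free_lie"
  shows "ev x = 0 \<longleftrightarrow> x \<in> F0_ideal \<alpha> \<beta> a"
proof
  assume ev0: "ev x = 0"
  obtain u where u: "u \<in> nc.span {s\<^sub>0, s\<^sub>1, s\<^sub>2 a, s\<^sub>3}" "x - u \<in> F0_ideal \<alpha> \<beta> a"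
    using F0_ideal_spanning[OF nonexc x] by blast
  obtain c0 where "u - smul c0 s\<^sub>0 \<in> nc.span {s\<^sub>1, s\<^sub>2 a, s\<^sub>3}"
    using u(1) nc.span_breakdown_eq[of u s\<^sub>0] by blast
  then obtain c1 where "u - smul c0 s\<^sub>0 - smul c1 s\<^sub>1 \<in> nc.span {s\<^sub>2 a, s\<^sub>3}"
    using nc.span_breakdown_eq[of _ s\<^sub>1] by blast
  then obtain c2 where "u - smul c0 s\<^sub>0 - smul c1 s\<^sub>1 - smul c2 (s\<^sub>2 a) \<in> nc.span {s\<^sub>3}"
    using nc.span_breakdown_eq[of _ "s\<^sub>2 a"] by blast
  then obtain c3 where "u - smul c0 s\<^sub>0 - smul c1 s\<^sub>1 - smul c2 (s\<^sub>2 a) - smul c3 s\<^sub>3 \<in> nc.span {}"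
    using nc.span_breakdown_eq[of _ s\<^sub>3] by blast
  then have u_eq: "u = smul c0 s\<^sub>0 + smul c1 s\<^sub>1 + smul c2 (s\<^sub>2 a) + smul c3 s\<^sub>3"
    by (simp add: algebra_simps)
  have "u \<in> free_lie" unfolding u_eq by (intro fl_add fl_smul s_free_lie)
  then have "ev u = 0"
    using ev_ideal[OF u(2)] ev0 x by (simp add: ev.hom_diff)
  then have M: "mscale c0 X\<^sub>0 + mscale c1 X\<^sub>1 + mscale c2 X\<^sub>2 + mscale c3 Y = 0"
    unfolding u_eq by (simp add: ev.hom_add ev.hom_smul fl_add fl_smul s_free_lie ev_s)
  note defs = X\<^sub>0_def X\<^sub>1_def X\<^sub>2_def Y_def mscale_def
  have e: "c0 + c1 * (2 * \<alpha>) = 0" "c0 - c1 * (2 * \<alpha>) = 0" "c2 = 0" "c3 = c0 / (4 * \<alpha>)"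
  proof -
    show "c0 + c1 * (2 * \<alpha>) = 0" using arg_cong[OF M, of "\<lambda>M. M $ 1 $ 1"] by (simp add: defs)
    show "c0 - c1 * (2 * \<alpha>) = 0" using arg_cong[OF M, of "\<lambda>M. M $ 2 $ 2"] by (simp add: defs)
    show "c2 = 0" using \<alpha> arg_cong[OF M, of "\<lambda>M. M $ 2 $ 1"] by (simp add: defs)
    show "c3 = c0 / (4 * \<alpha>)" using arg_cong[OF M, of "\<lambda>M. M $ 1 $ 2"] by (simp add: defs)
  qed
  have "2 * c0 = 0" using e(1,2) by algebra
  then have c0: "c0 = 0" by simp
  then have "c1 * (2 * \<alpha>) = 0" using e(1) by simp
  then have "c1 = 0" using \<alpha> by simp
  with c0 have "c0 = 0" "c1 = 0" "c2 = 0" "c3 = 0" using e \<alpha> by simp_all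
  then have "u = 0" unfolding u_eq by simp
  then show "x \<in> F0_ideal \<alpha> \<beta> a" using u(2) by simp
qed (rule ev_ideal)

lemma ev_surj: "\<exists>u\<in>free_lie. ev u = M"
proof -
  \<comment> \<open>The coordinates of M in the basis of images; \<open>c3\<close> also compensates
    the off-diagonal entry of \<open>X\<^sub>0\<close>.\<close>
  define c0 where "c0 = (M $ 1 $ 1 + M $ 2 $ 2) / 2"
  define c1 where "c1 = (M $ 1 $ 1 - M $ 2 $ 2) / (4 * \<alpha>)"
  define c2 where "c2 = M $ 2 $ 1 / (32 * \<alpha> ^ 3)"
  define c3 where "c3 = M $ 1 $ 2 + c0 / (4 * \<alpha>)"
  let ?u = "smul c0 s\<^sub>0 + smul c1 s\<^sub>1 + smul c2 (s\<^sub>2 a) + smul c3 s\<^sub>3"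
  have "ev ?u = mscale c0 X\<^sub>0 + mscale c1 X\<^sub>1 + mscale c2 X\<^sub>2 + mscale c3 Y"
    by (simp add: ev.hom_add ev.hom_smul fl_add fl_smul s_free_lie ev_s)
  also have "\<dots> = M"
    using \<alpha> by (simp add: X\<^sub>0_def X\<^sub>1_def X\<^sub>2_def Y_def c0_def c1_def c2_def c3_def mat2_entries field_simps)
  finally have "ev ?u = M" .
  moreover have "?u \<in> free_lie" by (intro fl_add fl_smul s_free_lie)
  ultimately show ?thesis by blast
qed

text \<open>The decomposition of gl_2 into sl_2 and scalar matrices, the scalar part being recorded
  by the trace in slot 0.\<close>

definition gl2_split :: "'k^2^2 \<Rightarrow> ('k^2^2) \<times> (nat \<Rightarrow> 'k)" where
  "gl2_split M = (M - mscale (trace M / 2) (mat 1), \<lambda>i. if i = 0 then trace M else 0)"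

lemma gl2_split_eqs:
  "gl2_split (M + N) = tgt_add (gl2_split M) (gl2_split N)" "gl2_split (mscale r M) = tgt_smul r (gl2_split M)"
  "gl2_split (commutator M N) = tgt_br (gl2_split M) (gl2_split N)"
  "gl2_split M = (0, \<lambda>i. 0) \<longleftrightarrow> M = 0"
  by (auto simp: gl2_split_def tgt_add_def tgt_smul_def tgt_br_def mat2_entries fun_eq_iff field_simps)

lemma range_gl2_split: "range gl2_split = tgt_set 1"
proof
  show "range gl2_split \<subseteq> tgt_set 1"
    by (auto simp: gl2_split_def tgt_set_def sl2_def mat2_entries field_simps)
  show "tgt_set 1 \<subseteq> range gl2_split"
  proof
    fix p :: "('k^2^2) \<times> (nat \<Rightarrow> 'k)" assume p: "p \<in> tgt_set 1"
    obtain N v where pv: "p = (N, v)" by (cases p)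
    have "trace N = 0" and v: "\<And>i. i \<noteq> 0 \<Longrightarrow> v i = 0"
      using p by (auto simp: pv tgt_set_def sl2_def)
    then have N: "N $ 2 $ 2 = - N $ 1 $ 1" by (simp add: mat2_entries eq_neg_iff_add_eq_0 add.commute)
    have "p = gl2_split (N + mscale (v 0 / 2) (mat 1))"
      by (auto simp: pv gl2_split_def mat2_entries N v fun_eq_iff field_simps)
    then show "p \<in> range gl2_split" by blast
  qed
qed

lemma quot_iso:
  assumes "6 * \<alpha> + \<beta> \<noteq> 0" "\<alpha> + \<beta> \<noteq> 0" "16 * \<alpha> + \<beta> \<noteq> 0"
  shows "quot_iso_sl2_ab (F0_ideal \<alpha> \<beta> a) 1"
  unfolding quot_iso_sl2_ab_def
proof (intro exI[of _ "\<lambda>x. gl2_split (ev x)"] conjI ballI allI)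
  have "M \<in> ev ` free_lie" for M using ev_surj[of M] by blast
  then have "ev ` free_lie = UNIV" by blast
  then show "(\<lambda>x. gl2_split (ev x)) ` free_lie = tgt_set 1"
    using range_gl2_split by (metis image_image)
qed (simp_all add: ev.hom_add ev.hom_smul ev.hom_br gl2_split_eqs ev_kernel[OF assms])

end

lemma quot_dim_le_mono: "quot_dim_le I m \<Longrightarrow> m \<le> n \<Longrightarrow> quot_dim_le I n"
  unfolding quot_dim_le_def by (meson le_trans)

theorem theorem4p9:
  fixes \<alpha> \<beta> :: "'k::{real_normed_field, banach}"
    and a :: "nat \<Rightarrow> 'k"
  shows "(\<alpha> + \<beta> \<noteq> 0 \<and> 6 * \<alpha> + \<beta> \<noteq> 0 \<and> 16 * \<alpha> + \<beta> \<noteq> 0 \<and> \<alpha> \<noteq> 0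
           \<longrightarrow> (\<exists>n\<le>3. quot_iso_sl2_ab (F0_ideal \<alpha> \<beta> a) n))
       \<and> (\<alpha> = 0 \<and> \<beta> \<noteq> 0
           \<longrightarrow> quot_nilpotent (F0_ideal \<alpha> \<beta> a) \<and> quot_dim_le (F0_ideal \<alpha> \<beta> a) 6)"
proof (intro conjI impI)
  assume h: "\<alpha> + \<beta> \<noteq> 0 \<and> 6 * \<alpha> + \<beta> \<noteq> 0 \<and> 16 * \<alpha> + \<beta> \<noteq> 0 \<and> \<alpha> \<noteq> 0"
  then interpret gl2_model \<alpha> \<beta> a by unfold_locales simp
  \<comment> \<open>The abelian summand is the one-dimensional centre of gl_2.\<close>
  have "quot_iso_sl2_ab (F0_ideal \<alpha> \<beta> a) 1" using h by (intro quot_iso) auto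
  then show "\<exists>n\<le>3. quot_iso_sl2_ab (F0_ideal \<alpha> \<beta> a) n" by (intro exI[of _ 1]) simp
next
  assume h: "\<alpha> = 0 \<and> \<beta> \<noteq> 0"
  then show "quot_nilpotent (F0_ideal \<alpha> \<beta> a)" using F0_nilpotent by blast
  have "quot_dim_le (F0_ideal \<alpha> \<beta> a) 4" using h by (intro F0_dim_le) auto
  then show "quot_dim_le (F0_ideal \<alpha> \<beta> a) 6"
    by (rule quot_dim_le_mono) simp
qed

end
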